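(* Let $n>1$, $p\ge1$ and $g\ge1$. Identify $B_n(N_{g,p})$ with the subgroup of $B_{n+1}(N_{g,p})$ generated by $\sigma_1,\dots,\sigma_{n-1},a_1,\dots,a_g,z_1,\dots,z_{p-1}$. Then $B_n(N_{g,p})$ acts by conjugation, $u\mapsto u^\beta=\beta^{-1}u\beta$, on the free group $W_{n,g,p}$ with basis $\tau_1,\dots,\tau_n,w_1,\dots,w_g,\xi_1,\dots,\xi_{p-1}$, and the induced representation $\rho_W:B_n(N_{g,p})\to\mathrm{Aut}(W_{n,g,p})$ is given as follows. Generators $\sigma_i$, $1\le i\le n-1$: $\tau_i\mapsto\tau_{i+1}^{\tau_i^{-1}}$; $\tau_{i+1}\mapsto\tau_i$; $\tau_l\mapsto\tau_l$ for $l\ne i,i+1$; $w_r\mapsto w_r$ for $1\le r\le g$; $\xi_j\mapsto\xi_j$ for $1\le j\le p-1$. Generators $a_r$, $1\le r\le g$: $\tau_1\mapsto(\tau_1^{-1})^{w_r^{-1}\tau_1}$; $\tau_i\mapsto\tau_i$ for $2\le i\le n$; $w_s\mapsto w_s^{w_r\tau_1w_r^{-1}\tau_1}$ for $1\le s<r$; $w_r\mapsto\tau_1^{-1}w_r$; $w_s\mapsto w_s$ for $r<s\le g$; $\xi_j\mapsto\xi_j^{w_r\tau_1w_r^{-1}\tau_1}$ for $1\le j\le p-1$. Generators $z_j$, $1\le j\le p-1$: $\tau_1\mapsto[\tau_1,\xi_j^{-1}]\tau_1$; $\tau_i\mapsto\tau_i$ for $2\le i\le n$; $w_r\mapsto w_r$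 for $1\le r\le g$; $\xi_l\mapsto\xi_l^{[\xi_j^{-1},\tau_1]}$ for $1\le l<j$; $\xi_j\mapsto\xi_j^{\tau_1}$; $\xi_l\mapsto\xi_l$ for $j<l\le p-1$.
   Context: Conventions: $a^b=b^{-1}ab$ and $[a,b]=a^{-1}b^{-1}ab$. Automorphisms act on the right: a product $\alpha\beta$ of automorphisms means first $\alpha$, then $\beta$. $N_{g,p}$ is the compact connected non-orientable surface of genus $g$ with $p$ boundary components. $B_m(\Sigma)$ is the $m$-strand braid group of the surface $\Sigma$: isotopy classes (rel endpoints) of $m$-tuples of disjoint paths in $\Sigma\times[0,1]$, monotone in the $[0,1]$ coordinate, from $\mathcal P\times\{0\}$ to $\mathcal P\times\{1\}$, where $\mathcal P$ is a fixed set of $m$ interior points. For $p>0$ and $m\ge2$, $B_m(N_{g,p})$ has the following presentation (known). Generators $\sigma_1,\dots,\sigma_{m-1},a_1,\dots,a_g,z_1,\dots,z_{p-1}$ (the $\sigma_i$ are the standard braid generators of an embedded disk; the $a_r,z_j$ are the usual generators of $\pi_1(N_{g,p})$, performed by the first strand). Relations: $\sigma_i\sigma_{i+1}\sigma_i=\sigma_{i+1}\sigma_i\sigma_{i+1}$; $\sigma_i\sigma_j=\sigma_j\sigma_i$ for $|i-j|>1$; $a_r\sigma_i=\sigma_ia_r$ and $z_j\sigma_i=\sigma_iz_j$ for $i\neq1$; $\sigma_1^{-1}a_r\sigma_1^{-1}a_r=a_r\sigma_1^{-1}a_r\sigma_1$; $(\sigma_1^{-1}a_s\sigma_1)a_r=a_r(\sigma_1^{-1}a_s\sigma_1)$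 for $s<r$; $(\sigma_1^{-1}z_j\sigma_1)a_r=a_r(\sigma_1^{-1}z_j\sigma_1)$; $(\sigma_1^{-1}z_j\sigma_1)z_l=z_l(\sigma_1^{-1}z_j\sigma_1)$ for $j<l$; $(\sigma_1^{-1}z_j\sigma_1^{-1})z_j=z_j(\sigma_1^{-1}z_j\sigma_1^{-1})$. The subgroup of $B_{n+1}(N_{g,p})$ generated by $\sigma_1,\dots,\sigma_{n-1},a_1,\dots,a_g,z_1,\dots,z_{p-1}$ is isomorphic to $B_n(N_{g,p})$ via the obvious correspondence of generators. In $B_{n+1}(N_{g,p})$ put $\tau_k=\sigma_n\cdots\sigma_{k+1}\sigma_k^2\sigma_{k+1}^{-1}\cdots\sigma_n^{-1}$ ($1\le k\le n-1$), $\tau_n=\sigma_n^2$, $w_r=\sigma_n\cdots\sigma_1a_r\sigma_1^{-1}\cdots\sigma_n^{-1}$ ($1\le r\le g$), $\xi_j=\sigma_n\cdots\sigma_1z_j\sigma_1^{-1}\cdots\sigma_n^{-1}$ ($1\le j\le p-1$). $W_{n,g,p}$ is the subgroup of $B_{n+1}(N_{g,p})$ generated by all $\tau_k,w_r,\xi_j$; it is known to be free on these generators. *)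

theory Defs
  imports "HOL-Analysis.Analysis" "HOL-Algebra.Generated_Groups" "HOL-Algebra.Bij"
begin

section \<open>Non-orientable surfaces\<close>

text \<open>
  The model of \<open>N\<^sub>g\<^sub>,\<^sub>p\<close> is the sphere with \<open>g + p\<close> disjoint open round caps removed, the first
  \<open>g\<close> boundary circles being closed up to crosscaps by identifying their antipodal points.
  The caps are centred at equidistant points of the equator and have angular radius
  \<open>pi / (2 (g + p))\<close>, so their closures are disjoint.
\<close>

definition cap_centre :: "nat \<Rightarrow> nat \<Rightarrow> complex \<times> real" where
  "cap_centre N k = (cis (2 * pi * real k / real N), 0)"

definition holed_sphere :: "nat \<Rightarrow> nat \<Rightarrow> (complex \<times> real) set" where
  "holed_sphere g p =
     {x \<in> sphere 0 1. \<forall>k<g + p. x \<bullet> cap_centre (g + p) k \<le> cos (pi / (2 * real (g + p)))}"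

text \<open>
  The map \<open>x \<mapsto> 2 (x \<bullet> c) c - x\<close> is the rotation by the angle \<open>pi\<close> about the axis through \<open>c\<close>;
  on a circle of the sphere centred at \<open>c\<close> it is the antipodal map of that circle.
\<close>

definition crosscap_rel :: "nat \<Rightarrow> nat \<Rightarrow> complex \<times> real \<Rightarrow> complex \<times> real \<Rightarrow> bool" where
  "crosscap_rel g p x y \<longleftrightarrow>
     x = y \<or>
     (\<exists>k<g. x \<bullet> cap_centre (g + p) k = cos (pi / (2 * real (g + p))) \<and>
            y = (2 * (x \<bullet> cap_centre (g + p) k)) *\<^sub>R cap_centre (g + p) k - x)"

definition nonorientable_surface :: "nat \<Rightarrow> nat \<Rightarrow> 'a topology \<Rightarrow> bool" where
  "nonorientable_surface g p \<Sigma> \<longleftrightarrow>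
     (\<exists>q. quotient_map (top_of_set (holed_sphere g p)) \<Sigma> q \<and>
          (\<forall>x\<in>holed_sphere g p. \<forall>y\<in>holed_sphere g p. q x = q y \<longleftrightarrow> crosscap_rel g p x y))"

definition surface_interior :: "'a topology \<Rightarrow> 'a set" where
  "surface_interior \<Sigma> =
     {x. \<exists>U. openin \<Sigma> U \<and> x \<in> U \<and>
          subtopology \<Sigma> U homeomorphic_space top_of_set (ball (0 :: complex) 1)}"

section \<open>Surface braid groups\<close>

text \<open>
  A path in \<open>\<Sigma> \<times> [0,1]\<close> that is monotone in the second coordinate is parametrized by that
  coordinate. So the \<open>i\<close>-th strand of the braid \<open>b\<close> is the path \<open>t \<mapsto> (b (i, t), t)\<close>, and
  two strands are disjoint iff they differ at every level \<open>t\<close>.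
  The strands are numbered by \<open>1, \<dots>, m\<close>, the \<open>i\<close>-th one starting at the base point \<open>P i\<close>.
\<close>

definition strand_space :: "nat \<Rightarrow> (nat \<times> real) topology" where
  "strand_space m = prod_topology (discrete_topology {1..m}) (top_of_set {0..1})"

definition geometric_braids ::
  "'a topology \<Rightarrow> (nat \<Rightarrow> 'a) \<Rightarrow> nat \<Rightarrow> (nat \<times> real \<Rightarrow> 'a) set" where
  "geometric_braids \<Sigma> P m =
     {b. continuous_map (strand_space m) \<Sigma> b \<and>
         (\<forall>i\<in>{1..m}. b (i, 0) = P i \<and> b (i, 1) \<in> P ` {1..m}) \<and>
         (\<forall>t\<in>{0..1}. inj_on (\<lambda>i. b (i, t)) {1..m})}"

definition braid_isotopic ::
  "'a topology \<Rightarrow> (nat \<Rightarrow> 'a) \<Rightarrow> nat \<Rightarrow> (nat \<times> real \<Rightarrow> 'a) \<Rightarrow> (nat \<times> real \<Rightarrow> 'a) \<Rightarrow> bool" where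
  "braid_isotopic \<Sigma> P m b c \<longleftrightarrow>
     homotopic_with (\<lambda>f. f \<in> geometric_braids \<Sigma> P m \<and> (\<forall>i\<in>{1..m}. f (i, 1) = b (i, 1)))
       (strand_space m) \<Sigma> b c"

definition braid_class ::
  "'a topology \<Rightarrow> (nat \<Rightarrow> 'a) \<Rightarrow> nat \<Rightarrow> (nat \<times> real \<Rightarrow> 'a) \<Rightarrow> (nat \<times> real \<Rightarrow> 'a) set" where
  "braid_class \<Sigma> P m b = {c. braid_isotopic \<Sigma> P m b c}"

text \<open>The strand \<open>i\<close> of \<open>b\<close> is continued by that strand of \<open>c\<close> which starts where it ends.\<close>

definition braid_comp ::
  "(nat \<Rightarrow> 'a) \<Rightarrow> nat \<Rightarrow> (nat \<times> real \<Rightarrow> 'a) \<Rightarrow> (nat \<times> real \<Rightarrow> 'a) \<Rightarrow> nat \<times> real \<Rightarrow> 'a" where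
  "braid_comp P m b c =
     (\<lambda>(i, t). if t \<le> 1 / 2 then b (i, 2 * t)
               else c (inv_into {1..m} P (b (i, 1)), 2 * t - 1))"

definition braid_group ::
  "'a topology \<Rightarrow> (nat \<Rightarrow> 'a) \<Rightarrow> nat \<Rightarrow> (nat \<times> real \<Rightarrow> 'a) set monoid" where
  "braid_group \<Sigma> P m =
     \<lparr>carrier = braid_class \<Sigma> P m ` geometric_braids \<Sigma> P m,
      mult = (\<lambda>A B. {d. \<exists>b\<in>A. \<exists>c\<in>B. braid_isotopic \<Sigma> P m (braid_comp P m b c) d}),
      one = braid_class \<Sigma> P m (\<lambda>(i, t). P i)\<rparr>"

section \<open>Presentations and free groups\<close>

text \<open>A word is a list of letters; \<open>(x, True)\<close> stands for \<open>x\<close> and \<open>(x, False)\<close> for its inverse.\<close>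

type_synonym 'x word = "('x \<times> bool) list"

definition pos :: "'x \<Rightarrow> 'x word" where "pos x = [(x, True)]"
definition neg :: "'x \<Rightarrow> 'x word" where "neg x = [(x, False)]"

text \<open>Equality of words in the group with generators \<open>X\<close> and defining relations \<open>R\<close>.\<close>

inductive pres_eq :: "'x set \<Rightarrow> ('x word \<times> 'x word) set \<Rightarrow> 'x word \<Rightarrow> 'x word \<Rightarrow> bool"
  for X R where
  refl: "pres_eq X R u u"
| sym: "pres_eq X R u v \<Longrightarrow> pres_eq X R v u"
| trans: "pres_eq X R u v \<Longrightarrow> pres_eq X R v w \<Longrightarrow> pres_eq X R u w"
| cong: "pres_eq X R u v \<Longrightarrow> pres_eq X R (s @ u @ t) (s @ v @ t)"
| cancel: "x \<in> X \<Longrightarrow> pres_eq X R [(x, e), (x, \<not> e)] []"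
| rel: "(u, v) \<in> R \<Longrightarrow> pres_eq X R u v"

definition word_val :: "('g, 'b) monoid_scheme \<Rightarrow> ('x \<Rightarrow> 'g) \<Rightarrow> 'x word \<Rightarrow> 'g" where
  "word_val G f w =
     foldr (\<lambda>(x, e) y. (if e then f x else inv\<^bsub>G\<^esub> (f x)) \<otimes>\<^bsub>G\<^esub> y) w \<one>\<^bsub>G\<^esub>"

definition has_presentation ::
  "('g, 'b) monoid_scheme \<Rightarrow> ('x \<Rightarrow> 'g) \<Rightarrow> 'x set \<Rightarrow> ('x word \<times> 'x word) set \<Rightarrow> bool" where
  "has_presentation G f X R \<longleftrightarrow>
     group G \<and> f ` X \<subseteq> carrier G \<and> generate G (f ` X) = carrier G \<and>
     (\<forall>u\<in>lists (X \<times> UNIV). \<forall>v\<in>lists (X \<times> UNIV).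
        word_val G f u = word_val G f v \<longleftrightarrow> pres_eq X R u v)"

text \<open>
  Freely generated: two words have the same value iff they are freely equal. In particular
  \<open>f\<close> is injective on \<open>X\<close>.
\<close>

definition freely_generated :: "('g, 'b) monoid_scheme \<Rightarrow> ('x \<Rightarrow> 'g) \<Rightarrow> 'x set \<Rightarrow> bool" where
  "freely_generated G f X \<longleftrightarrow> has_presentation G f X {}"

section \<open>The presentation of the braid groups of non-orientable surfaces\<close>

datatype braid_gen = Sigma_gen nat | A_gen nat | Z_gen nat

definition braid_gens :: "nat \<Rightarrow> nat \<Rightarrow> nat \<Rightarrow> braid_gen set" where
  "braid_gens m g p = Sigma_gen ` {1..m - 1} \<union> A_gen ` {1..g} \<union> Z_gen ` {1..p - 1}"

definition braid_rels :: "nat \<Rightarrow> nat \<Rightarrow> nat \<Rightarrow> (braid_gen word \<times> braid_gen word) set" where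
  "braid_rels m g p =
   (let s = (\<lambda>i. pos (Sigma_gen i)); s' = (\<lambda>i. neg (Sigma_gen i));
        a = (\<lambda>r. pos (A_gen r)); z = (\<lambda>j. pos (Z_gen j));
        I = {1..m - 1}; A = {1..g}; Z = {1..p - 1}
    in {(s i @ s (i + 1) @ s i, s (i + 1) @ s i @ s (i + 1)) | i. i \<in> I \<and> i + 1 \<in> I}
     \<union> {(s i @ s j, s j @ s i) | i j. i \<in> I \<and> j \<in> I \<and> \<bar>int i - int j\<bar> > 1}
     \<union> {(a r @ s i, s i @ a r) | r i. r \<in> A \<and> i \<in> I \<and> i \<noteq> 1}
     \<union> {(z j @ s i, s i @ z j) | j i. j \<in> Z \<and> i \<in> I \<and> i \<noteq> 1}
     \<union> {(s' 1 @ a r @ s' 1 @ a r, a r @ s' 1 @ a r @ s 1) | r. r \<in> A}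
     \<union> {(s' 1 @ a t @ s 1 @ a r, a r @ s' 1 @ a t @ s 1) | t r. t \<in> A \<and> r \<in> A \<and> t < r}
     \<union> {(s' 1 @ z j @ s 1 @ a r, a r @ s' 1 @ z j @ s 1) | j r. j \<in> Z \<and> r \<in> A}
     \<union> {(s' 1 @ z j @ s 1 @ z l, z l @ s' 1 @ z j @ s 1) | j l. j \<in> Z \<and> l \<in> Z \<and> j < l}
     \<union> {(s' 1 @ z j @ s' 1 @ z j, z j @ s' 1 @ z j @ s' 1) | j. j \<in> Z})"

section \<open>The group W and the conjugation action\<close>

definition conj_by :: "('g, 'b) monoid_scheme \<Rightarrow> 'g \<Rightarrow> 'g \<Rightarrow> 'g" where
  "conj_by G a b = inv\<^bsub>G\<^esub> b \<otimes>\<^bsub>G\<^esub> a \<otimes>\<^bsub>G\<^esub> b"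

definition commutator :: "('g, 'b) monoid_scheme \<Rightarrow> 'g \<Rightarrow> 'g \<Rightarrow> 'g" where
  "commutator G a b = inv\<^bsub>G\<^esub> a \<otimes>\<^bsub>G\<^esub> inv\<^bsub>G\<^esub> b \<otimes>\<^bsub>G\<^esub> a \<otimes>\<^bsub>G\<^esub> b"

text \<open>\<open>sigma_desc G f n k\<close> is \<open>\<sigma>\<^sub>n \<sigma>\<^sub>n\<^sub>-\<^sub>1 \<cdots> \<sigma>\<^sub>k\<close>, which is the empty product for \<open>k = n + 1\<close>.\<close>

definition sigma_desc :: "('g, 'b) monoid_scheme \<Rightarrow> (braid_gen \<Rightarrow> 'g) \<Rightarrow> nat \<Rightarrow> nat \<Rightarrow> 'g" where
  "sigma_desc G f n k = word_val G f (map (\<lambda>i. (Sigma_gen i, True)) (rev [k..<n + 1]))"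

datatype W_gen = Tau nat | Omega nat | Xi nat

definition W_gens :: "nat \<Rightarrow> nat \<Rightarrow> nat \<Rightarrow> W_gen set" where
  "W_gens n g p = Tau ` {1..n} \<union> Omega ` {1..g} \<union> Xi ` {1..p - 1}"

primrec W_elem :: "('g, 'b) monoid_scheme \<Rightarrow> (braid_gen \<Rightarrow> 'g) \<Rightarrow> nat \<Rightarrow> W_gen \<Rightarrow> 'g" where
  "W_elem G f n (Tau k) =
     sigma_desc G f n (k + 1) \<otimes>\<^bsub>G\<^esub> (f (Sigma_gen k) [^]\<^bsub>G\<^esub> (2::nat))
       \<otimes>\<^bsub>G\<^esub> inv\<^bsub>G\<^esub> (sigma_desc G f n (k + 1))"
| "W_elem G f n (Omega r) =
     sigma_desc G f n 1 \<otimes>\<^bsub>G\<^esub> f (A_gen r) \<otimes>\<^bsub>G\<^esub> inv\<^bsub>G\<^esub> (sigma_desc G f n 1)"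
| "W_elem G f n (Xi j) =
     sigma_desc G f n 1 \<otimes>\<^bsub>G\<^esub> f (Z_gen j) \<otimes>\<^bsub>G\<^esub> inv\<^bsub>G\<^esub> (sigma_desc G f n 1)"

definition subgroup_on :: "('g, 'b) monoid_scheme \<Rightarrow> 'g set \<Rightarrow> ('g, 'b) monoid_scheme" where
  "subgroup_on G S = G\<lparr>carrier := generate G S\<rparr>"

text \<open>
  The automorphism group with automorphisms acting on the right: the product of \<open>\<alpha>\<close> and \<open>\<beta>\<close>
  means first \<open>\<alpha>\<close>, then \<open>\<beta>\<close>.
\<close>

definition right_AutoGroup :: "('g, 'b) monoid_scheme \<Rightarrow> ('g \<Rightarrow> 'g) monoid" where
  "right_AutoGroup G =
     AutoGroup G\<lparr>mult := \<lambda>\<alpha> \<beta>. \<beta> \<otimes>\<^bsub>AutoGroup G\<^esub> \<alpha>\<rparr>"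

end

theory Submission
  imports Defs
begin

text \<open>
  The conjugation formulas are consequences of the relations: the generators \<open>a\<^sub>r\<close> and \<open>z\<^sub>j\<close> commute with
  \<open>\<sigma>\<^sub>2, \<dots>, \<sigma>\<^sub>n\<close>, so after removing the common conjugator \<open>\<sigma>\<^sub>n \<cdots> \<sigma>\<^sub>2\<close> only identities between
  \<open>\<sigma>\<^sub>1\<close>, \<open>a\<^sub>r\<close> and \<open>z\<^sub>j\<close> remain.

  For the freeness of \<open>W\<close>, let \<open>F\<close> be the abstract free group on the letters \<open>\<tau>\<^sub>k, w\<^sub>r, \<xi>\<^sub>j\<close>. If \<open>W\<close> is free, the
  right cosets of \<open>B\<^sub>n\<close> in \<open>B\<^sub>n\<^sub>+\<^sub>1\<close> are represented by the products \<open>u \<sigma>\<^sub>n \<cdots> \<sigma>\<^sub>k\<close> with \<open>u \<in> F\<close> and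
  \<open>1 \<le> k \<le> n + 1\<close>, and right multiplication by the generators is given on the pairs \<open>(u, k)\<close> by explicit
  formulas. Conversely, these formulas define permutations of the pairs, and they satisfy the relations of
  \<open>B\<^sub>n\<^sub>+\<^sub>1\<close>. A word in the generators of \<open>W\<close> maps \<open>(1, n + 1)\<close> to \<open>(u, n + 1)\<close>, where \<open>u\<close> is its value
  in \<open>F\<close>, so its value in \<open>B\<^sub>n\<^sub>+\<^sub>1\<close> determines it up to free equality.
\<close>

section \<open>Free groups\<close>

lemma pres_eq_append:
  assumes "pres_eq X R u u'" "pres_eq X R v v'"
  shows "pres_eq X R (u @ v) (u' @ v')"
  using pres_eq.cong[OF assms(1), of "[]" v] pres_eq.cong[OF assms(2), of u' "[]"]
  by (auto intro: pres_eq.trans)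

definition inv_word :: "'x word \<Rightarrow> 'x word" where
  "inv_word w = rev (map (\<lambda>(x, e). (x, \<not> e)) w)"

lemma inv_word_simps [simp]:
  "inv_word [] = []" "inv_word (u @ v) = inv_word v @ inv_word u"
  "inv_word ((x, e) # w) = inv_word w @ [(x, \<not> e)]"
  by (simp_all add: inv_word_def)

lemma pres_eq_inv_word_left: "pres_eq UNIV R (inv_word w @ w) []"
proof (induction w)
  case (Cons a w)
  obtain x e where a: "a = (x, e)" by (cases a)
  have "pres_eq UNIV R ([(x, \<not> e), (x, \<not> \<not> e)]) []"
    by (rule pres_eq.cancel) simp
  from pres_eq.cong[OF this, of "inv_word w" w] show ?case
    using Cons by (auto simp: a intro: pres_eq.trans)
qed (simp add: pres_eq.refl)

text \<open>Insert \<open>v\<close> and its inverse after \<open>inv_word u\<close>, trade that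
  \<open>v\<close> for \<open>u\<close> and cancel on the left: what remains is
  \<open>inv_word v\<close>.\<close>

lemma pres_eq_inv_word: "pres_eq UNIV R u v \<Longrightarrow> pres_eq UNIV R (inv_word u) (inv_word v)"
proof -
  assume uv: "pres_eq UNIV R u v"
  have inv_inv: "inv_word (inv_word w) = w" for w :: "'x word"
    by (induction w) auto
  have "pres_eq UNIV R (inv_word u @ (v @ inv_word v)) (inv_word u @ (u @ inv_word v))"
    by (intro pres_eq_append pres_eq.refl pres_eq.sym[OF uv])
  moreover have "pres_eq UNIV R ((inv_word u @ u) @ inv_word v) ([] @ inv_word v)"
    by (intro pres_eq_append pres_eq.refl pres_eq_inv_word_left)
  moreover have "pres_eq UNIV R (inv_word u @ []) (inv_word u @ (v @ inv_word v))"
    by (intro pres_eq_append pres_eq.refl pres_eq.sym[OF pres_eq_inv_word_left[of R "inv_word v", unfolded inv_inv]])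
  ultimately show ?thesis
    by (auto intro: pres_eq.trans)
qed

\<comment> \<open>The alphabet is the whole type, so that words need no side condition;
  \<open>pres_eq_restrict_alphabet\<close> returns to a given set of letters. The class
  \<open>group_add\<close> is additive notation for groups that need not be commutative.\<close>
quotient_type 'x free_group = "'x word" / "pres_eq UNIV {}"
  by (intro equivpI reflpI sympI transpI) (auto intro: pres_eq.refl pres_eq.sym pres_eq.trans)

instantiation free_group :: (type) group_add
begin

lift_definition zero_free_group :: "'a free_group" is "[]" .

lift_definition plus_free_group :: "'a free_group \<Rightarrow> 'a free_group \<Rightarrow> 'a free_group" is "(@)"
  by (rule pres_eq_append)

lift_definition uminus_free_group :: "'a free_group \<Rightarrow> 'a free_group" is inv_word
  by (rule pres_eq_inv_word)

definition minus_free_group :: "'a free_group \<Rightarrow> 'a free_group \<Rightarrow> 'a free_group" where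
  "minus_free_group x y = x + - y"

instance
proof
  fix a b c :: "'a free_group"
  show "a + b + c = a + (b + c)" by transfer (simp add: pres_eq.refl)
  show "0 + a = a" by transfer (simp add: pres_eq.refl)
  show "a + 0 = a" by transfer (simp add: pres_eq.refl)
  show "- a + a = 0" by transfer (rule pres_eq_inv_word_left)
  show "a + - b = a - b" by (simp add: minus_free_group_def)
qed

end

lift_definition gen :: "'x \<Rightarrow> 'x free_group" is pos .

definition word_sum :: "('x \<Rightarrow> 'b :: group_add) \<Rightarrow> 'x word \<Rightarrow> 'b" where
  "word_sum \<phi> w = sum_list (map (\<lambda>(x, e). if e then \<phi> x else - \<phi> x) w)"

lemma word_sum_simps [simp]:
  "word_sum \<phi> [] = 0" "word_sum \<phi> ((x, e) # w) = (if e then \<phi> x else - \<phi> x) + word_sum \<phi> w"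
  "word_sum \<phi> (u @ v) = word_sum \<phi> u + word_sum \<phi> v"
  by (simp_all add: word_sum_def)

lemma word_sum_inv_word [simp]: "word_sum \<phi> (inv_word w) = - word_sum \<phi> w"
  by (induction w) (auto simp: minus_add)

text \<open>The universal property of the free group: the homomorphism that extends
  \<open>\<phi>\<close>.\<close>

lift_definition free_ext :: "('x \<Rightarrow> 'b :: group_add) \<Rightarrow> 'x free_group \<Rightarrow> 'b" is word_sum
proof -
  fix \<phi> :: "'x \<Rightarrow> 'b" and u v :: "'x word"
  assume "pres_eq UNIV {} u v"
  thus "word_sum \<phi> u = word_sum \<phi> v" by induction auto
qed

lemma free_ext_simps [simp]:
  "free_ext \<phi> 0 = 0" "free_ext \<phi> (a + b) = free_ext \<phi> a + free_ext \<phi> b"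
  "free_ext \<phi> (- a) = - free_ext \<phi> a" "free_ext \<phi> (gen x) = \<phi> x"
  by (transfer, simp add: pos_def)+

lemma word_sum_gen: "word_sum gen w = abs_free_group w"
proof (induction w)
  case Nil
  show ?case by (simp add: zero_free_group_def)
next
  case (Cons a w)
  obtain x e where a: "a = (x, e)" by (cases a)
  have "(if e then gen x else - gen x) = abs_free_group [(x, e)]"
    by (simp add: gen.abs_eq uminus_free_group.abs_eq pos_def)
  thus ?case by (simp add: a Cons plus_free_group.abs_eq)
qed

lemma word_sum_gen_eq_iff: "word_sum gen u = word_sum gen v \<longleftrightarrow> pres_eq UNIV {} u v"
  by (simp add: word_sum_gen free_group.abs_eq_iff)

text \<open>Reduces an identity between homomorphisms to the letters; every relation between twists
  is checked this way.\<close>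

lemma free_group_induct [case_names zero gen uminus plus]:
  assumes zero: "Q 0" and gen: "\<And>x. Q (gen x)" and uminus: "\<And>a. Q a \<Longrightarrow> Q (- a)"
    and plus: "\<And>a b. Q a \<Longrightarrow> Q b \<Longrightarrow> Q (a + b)"
  shows "Q a"
proof -
  obtain w where "a = abs_free_group w" by (induct a rule: free_group.abs_induct) blast
  hence "a = word_sum gen w" by (simp add: word_sum_gen)
  moreover have "Q (word_sum gen w)"
    by (induction w) (auto intro!: plus uminus intro: zero gen)
  ultimately show ?thesis by simp
qed

text \<open>Deleting the letters outside \<open>X\<close> respects free equality.\<close>

lemma pres_eq_restrict_alphabet:
  assumes "pres_eq UNIV {} u v" "u \<in> lists (X \<times> UNIV)" "v \<in> lists (X \<times> UNIV)"
  shows "pres_eq X {} u v"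
proof -
  let ?F = "filter (\<lambda>(x, e). x \<in> X)"
  have "pres_eq X {} (?F u) (?F v)"
    using assms(1) by induction (auto intro: pres_eq.intros)
  moreover have "?F w = w" if "w \<in> lists (X \<times> UNIV)" for w :: "('a \<times> bool) list"
    using that by (induction w) auto
  ultimately show ?thesis using assms by metis
qed

section \<open>The coset action\<close>

text \<open>This is \<open>a^b\<close> in additive notation, bracketed to the right like the normal
  form that \<open>group_add_normalize\<close> produces.\<close>

abbreviation (input) conj_add :: "'a :: group_add \<Rightarrow> 'a \<Rightarrow> 'a" where
  "conj_add a b \<equiv> - b + (a + b)"

abbreviation (input) "T k \<equiv> gen (Tau k)"
abbreviation (input) "Om r \<equiv> gen (Omega r)"
abbreviation (input) "X j \<equiv> gen (Xi j)"

text \<open>Here and in \<open>a_img\<close> and \<open>z_img\<close> the formulas of the theorem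
  serve as definitions in the abstract free group. The \<open>_inv_img\<close> maps come from
  solving these formulas for the letters; \<open>twist_cancel\<close> confirms that they are
  inverse.\<close>

primrec sigma_img :: "nat \<Rightarrow> W_gen \<Rightarrow> W_gen free_group" where
  "sigma_img i (Tau k) = (if k = i then T i + (T (Suc i) + - T i) else if k = Suc i then T i else T k)"
| "sigma_img i (Omega r) = Om r"
| "sigma_img i (Xi j) = X j"

primrec sigma_inv_img :: "nat \<Rightarrow> W_gen \<Rightarrow> W_gen free_group" where
  "sigma_inv_img i (Tau k) =
     (if k = i then T (Suc i) else if k = Suc i then conj_add (T i) (T (Suc i)) else T k)"
| "sigma_inv_img i (Omega r) = Om r"
| "sigma_inv_img i (Xi j) = X j"

primrec a_img :: "nat \<Rightarrow> W_gen \<Rightarrow> W_gen free_group" where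
  "a_img r (Tau k) = (if k = 1 then conj_add (- T 1) (- Om r + T 1) else T k)"
| "a_img r (Omega s) =
     (if s < r then conj_add (Om s) (Om r + (T 1 + (- Om r + T 1)))
      else if s = r then - T 1 + Om r else Om s)"
| "a_img r (Xi j) = conj_add (X j) (Om r + (T 1 + (- Om r + T 1)))"

primrec a_inv_img :: "nat \<Rightarrow> W_gen \<Rightarrow> W_gen free_group" where
  "a_inv_img r (Tau k) = (if k = 1 then conj_add (- T 1) (Om r) else T k)"
| "a_inv_img r (Omega s) =
     (if s < r then conj_add (Om s) (T 1 + (- Om r + (T 1 + Om r)))
      else if s = r then - Om r + (- T 1 + (Om r + Om r)) else Om s)"
| "a_inv_img r (Xi j) = conj_add (X j) (T 1 + (- Om r + (T 1 + Om r)))"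

primrec z_img :: "nat \<Rightarrow> W_gen \<Rightarrow> W_gen free_group" where
  "z_img j (Tau k) = (if k = 1 then - T 1 + (X j + (T 1 + (- X j + T 1))) else T k)"
| "z_img j (Omega s) = Om s"
| "z_img j (Xi l) =
     (if l < j then conj_add (X l) (X j + (- T 1 + (- X j + T 1)))
      else if l = j then conj_add (X j) (T 1) else X l)"

primrec z_inv_img :: "nat \<Rightarrow> W_gen \<Rightarrow> W_gen free_group" where
  "z_inv_img j (Tau k) = (if k = 1 then - X j + (T 1 + X j) else T k)"
| "z_inv_img j (Omega s) = Om s"
| "z_inv_img j (Xi l) =
     (if l < j then conj_add (X l) (T 1 + (- X j + (- T 1 + X j)))
      else if l = j then - X j + (T 1 + (X j + (- T 1 + X j))) else X l)"

primrec twist_img :: "braid_gen \<Rightarrow> bool \<Rightarrow> W_gen \<Rightarrow> W_gen free_group" where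
  "twist_img (Sigma_gen i) e = (if e then sigma_img i else sigma_inv_img i)"
| "twist_img (A_gen r) e = (if e then a_img r else a_inv_img r)"
| "twist_img (Z_gen j) e = (if e then z_img j else z_inv_img j)"

text \<open>In the braid group \<open>u x = x u^x\<close>. So for \<open>x\<close> in
  \<open>B\<^sub>n\<close>, right multiplication by \<open>x\<close> replaces \<open>u\<close> by
  \<open>u^x\<close> in the coset of \<open>u\<close>; \<open>twist x True\<close> is the candidate
  for this conjugation on \<open>F\<close>.\<close>

definition twist :: "braid_gen \<Rightarrow> bool \<Rightarrow> W_gen free_group \<Rightarrow> W_gen free_group" where
  "twist x e = free_ext (twist_img x e)"

lemma twist_simps [simp]:
  "twist x e 0 = 0" "twist x e (a + b) = twist x e a + twist x e b"
  "twist x e (- a) = - twist x e a" "twist x e (gen y) = twist_img x e y"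
  by (simp_all add: twist_def)

text \<open>Sums become right-bracketed sums of signed letters, on which the simplifier performs
  free cancellation. The rule \<open>add_uminus_conv_diff\<close> has to go, because it would
  restore differences.\<close>

lemmas group_add_normalize = add.assoc minus_add diff_conv_add_uminus

lemma twist_cancel: "twist x (\<not> e) (twist x e u) = u"
proof (induction u rule: free_group_induct)
  case (gen y)
  show ?case by (cases x; cases y; cases e) (auto simp: group_add_normalize simp del: add_uminus_conv_diff)
qed auto

section \<open>The relations of the braid group for the twists\<close>

lemma twist_sigma_braid:
  "twist (Sigma_gen i) True (twist (Sigma_gen (Suc i)) True (twist (Sigma_gen i) True u)) =
   twist (Sigma_gen (Suc i)) True (twist (Sigma_gen i) True (twist (Sigma_gen (Suc i)) True u))"
proof (induction u rule: free_group_induct)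
  case (gen y)
  show ?case by (cases y) (auto simp: group_add_normalize simp del: add_uminus_conv_diff)
qed auto

lemma twist_sigma_comm:
  assumes "Suc i < j \<or> Suc j < i"
  shows "twist (Sigma_gen i) True (twist (Sigma_gen j) True u) =
         twist (Sigma_gen j) True (twist (Sigma_gen i) True u)"
proof (induction u rule: free_group_induct)
  case (gen y)
  show ?case using assms by (cases y) (auto simp: group_add_normalize simp del: add_uminus_conv_diff)
qed auto

text \<open>The two twists involve disjoint sets of letters: \<open>\<sigma>\<^sub>i\<close> moves
  only \<open>T i\<close> and \<open>T (Suc i)\<close>, while the formulas for
  \<open>a\<^sub>r\<close> move and use only \<open>T 1\<close> and the letters \<open>Om\<close>
  and \<open>X\<close>.\<close>

lemma twist_a_sigma:
  assumes "i > 1"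
  shows "twist (Sigma_gen i) True (twist (A_gen r) True u) =
         twist (A_gen r) True (twist (Sigma_gen i) True u)"
proof (induction u rule: free_group_induct)
  case (gen y)
  show ?case using assms by (cases y) (auto simp: group_add_normalize simp del: add_uminus_conv_diff)
qed auto

lemma twist_z_sigma:
  assumes "i > 1"
  shows "twist (Sigma_gen i) True (twist (Z_gen j) True u) =
         twist (Z_gen j) True (twist (Sigma_gen i) True u)"
proof (induction u rule: free_group_induct)
  case (gen y)
  show ?case using assms by (cases y) (auto simp: group_add_normalize simp del: add_uminus_conv_diff)
qed auto

text \<open>The innermost twist belongs to the first letter of the relation, since right
  multiplication reads a word from left to right.\<close>

lemma twist_a_a:
  "twist (A_gen r) True (twist (Sigma_gen 1) False (twist (A_gen r) True (twist (Sigma_gen 1) False u))) =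
   twist (Sigma_gen 1) True (twist (A_gen r) True (twist (Sigma_gen 1) False (twist (A_gen r) True u)))"
proof (induction u rule: free_group_induct)
  case (gen y)
  show ?case by (cases y) (auto simp: group_add_normalize simp del: add_uminus_conv_diff)
qed auto

lemma twist_a_a_commute:
  assumes "t < r"
  shows "twist (A_gen r) True (twist (Sigma_gen 1) True (twist (A_gen t) True (twist (Sigma_gen 1) False u))) =
   twist (Sigma_gen 1) True (twist (A_gen t) True (twist (Sigma_gen 1) False (twist (A_gen r) True u)))"
proof (induction u rule: free_group_induct)
  case (gen y)
  show ?case using assms by (cases y) (auto simp: group_add_normalize simp del: add_uminus_conv_diff)
qed auto

lemma twist_z_a_commute:
  "twist (A_gen r) True (twist (Sigma_gen 1) True (twist (Z_gen j) True (twist (Sigma_gen 1) False u))) =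
   twist (Sigma_gen 1) True (twist (Z_gen j) True (twist (Sigma_gen 1) False (twist (A_gen r) True u)))"
proof (induction u rule: free_group_induct)
  case (gen y)
  show ?case by (cases y) (auto simp: group_add_normalize simp del: add_uminus_conv_diff)
qed auto

lemma twist_z_z_commute:
  assumes "j < l"
  shows "twist (Z_gen l) True (twist (Sigma_gen 1) True (twist (Z_gen j) True (twist (Sigma_gen 1) False u))) =
   twist (Sigma_gen 1) True (twist (Z_gen j) True (twist (Sigma_gen 1) False (twist (Z_gen l) True u)))"
proof (induction u rule: free_group_induct)
  case (gen y)
  show ?case using assms by (cases y) (auto simp: group_add_normalize simp del: add_uminus_conv_diff)
qed auto

lemma twist_z_z:
  "twist (Z_gen j) True (twist (Sigma_gen 1) False (twist (Z_gen j) True (twist (Sigma_gen 1) False u))) =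
   twist (Sigma_gen 1) False (twist (Z_gen j) True (twist (Sigma_gen 1) False (twist (Z_gen j) True u)))"
proof (induction u rule: free_group_induct)
  case (gen y)
  show ?case by (cases y) (auto simp: group_add_normalize simp del: add_uminus_conv_diff)
qed auto

text \<open>A pair \<open>(u, k)\<close> stands for the right coset of \<open>u \<sigma>\<^sub>n \<cdots> \<sigma>\<^sub>k\<close> modulo the subgroup \<open>B\<^sub>n\<close>; the index \<open>0\<close>
  does not occur.\<close>

fun step :: "braid_gen \<times> bool \<Rightarrow> W_gen free_group \<times> nat \<Rightarrow> W_gen free_group \<times> nat" where
  "step (Sigma_gen i, e) (u, k) =
     (if k = 0 then (u, k)
      else if Suc i < k then (twist (Sigma_gen i) e u, k)
      else if k = Suc i then (if e then u else u + - T i, i)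
      else if k = i then (if e then u + T i else u, Suc i)
      else (twist (Sigma_gen (i - 1)) e u, k))"
| "step (A_gen r, e) (u, k) =
     (if k = 0 then (u, k)
      else if k = 1 then (u + (if e then Om r else - Om r), k)
      else (twist (A_gen r) e u, k))"
| "step (Z_gen j, e) (u, k) =
     (if k = 0 then (u, k)
      else if k = 1 then (u + (if e then X j else - X j), k)
      else (twist (Z_gen j) e u, k))"

text \<open>With \<open>D k\<close> for \<open>\<sigma>\<^sub>n \<cdots> \<sigma>\<^sub>k\<close>,
  the clauses of \<open>step\<close> mirror
  \<open>D k \<sigma>\<^sub>i = \<sigma>\<^sub>i D k\<close> for \<open>i + 1 < k\<close>,
  \<open>D (i + 1) \<sigma>\<^sub>i = D i\<close>,
  \<open>D i \<sigma>\<^sub>i = \<tau>\<^sub>i D (i + 1)\<close>,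
  \<open>D k \<sigma>\<^sub>i = \<sigma>\<^sub>i\<^sub>-\<^sub>1 D k\<close> for
  \<open>k < i\<close>, \<open>D 1 a\<^sub>r = w\<^sub>r D 1\<close> and
  \<open>D 1 z\<^sub>j = \<xi>\<^sub>j D 1\<close>. Membership in \<open>braid_gens\<close> excludes
  \<open>Sigma_gen 0\<close>, which would send the index \<open>1\<close> to the dead index
  \<open>0\<close>.\<close>

lemma step_cancel:
  assumes "x \<in> braid_gens m g p"
  shows "step (x, \<not> e) (step (x, e) s) = s"
  using assms by (cases s; cases x; cases e)
    (auto simp: braid_gens_def twist_cancel[of _ True, simplified] twist_cancel[of _ False, simplified]
        add.assoc)

lemma step_sigma_comm:
  assumes "1 \<le> i" "Suc i < j"
  shows "step (Sigma_gen j, True) (step (Sigma_gen i, True) (x, k)) =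
         step (Sigma_gen i, True) (step (Sigma_gen j, True) (x, k))"
proof -
  obtain i' j' where ij: "i = Suc i'" "j = Suc j'" "Suc i' < j'"
    using assms by (cases i; cases j) auto
  \<comment> \<open>The letter \<open>Sigma_gen i\<close> twists by \<open>i - 1\<close> if
    \<open>k < i\<close> and by \<open>i\<close> if \<open>Suc i < k\<close>; otherwise it moves the
    index and adds at most \<open>T i\<close>, which the twist of the other letter fixes. As
    \<open>Suc i < j\<close>, the two letters never both move the index.\<close>
  consider "k = 0" | "0 < k" "k < i" | "k = i" | "k = Suc i" | "Suc i < k" "k < j" | "k = j" | "k = Suc j"
    | "Suc j < k"
    by linarith
  thus ?thesis
    by cases (use ij in \<open>simp_all add: twist_sigma_comm\<close>)
qed

text \<open>At indices that the letters do not move, the claim is the matching relation of twists,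
  with \<open>i - 1\<close> in place of \<open>i\<close> when \<open>k < i\<close>. At the few
  remaining indices it is a direct computation in \<open>F\<close>.\<close>

lemma fold_step_rel:
  assumes "(u, v) \<in> braid_rels m g p"
  shows "fold step u (x, k) = fold step v (x, k)"
  using assms unfolding braid_rels_def Let_def pos_def neg_def
  apply (elim UnE CollectE exE conjE)
          apply (simp_all del: One_nat_def step.simps)
  subgoal for i
    using twist_sigma_braid[of i x] twist_sigma_braid[of "i - 1" x]
    by (auto simp: add.assoc)
  subgoal for i j
    using step_sigma_comm[of i j x k] step_sigma_comm[of j i x k]
    by (cases "i < j") (simp_all del: step.simps)
  subgoal for r i
    using twist_a_sigma[of i r x] twist_a_sigma[of "i - 1" r x]
    by auto
  subgoal for j i
    using twist_z_sigma[of i j x] twist_z_sigma[of "i - 1" j x]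
    by auto
  subgoal for r
    using twist_a_a[of r x]
    by (auto simp: group_add_normalize simp del: add_uminus_conv_diff)
  subgoal for t r
    using twist_a_a_commute[of t r x]
    by (auto simp: group_add_normalize simp del: add_uminus_conv_diff)
  subgoal for j r
    using twist_z_a_commute[of r j x]
    by (auto simp: group_add_normalize simp del: add_uminus_conv_diff)
  subgoal for j l
    using twist_z_z_commute[of j l x]
    by (auto simp: group_add_normalize simp del: add_uminus_conv_diff)
  subgoal for j
    using twist_z_z[of j x]
    by (auto simp: group_add_normalize simp del: add_uminus_conv_diff)
  done

text \<open>The action descends from words to the presented group; this is how an equality in the
  braid group reaches \<open>F\<close>.\<close>

lemma fold_step_pres_eq:
  assumes "pres_eq (braid_gens m g p) (braid_rels m g p) u v"
  shows "fold step u = fold step v"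
  using assms
proof induction
  case (cancel x e)
  thus ?case by (auto simp: fun_eq_iff step_cancel)
next
  case (rel u v)
  thus ?case by (simp only: fun_eq_iff split_paired_All fold_step_rel simp_thms)
qed auto

section \<open>Words for the generators of W\<close>

text \<open>Since \<open>step\<close> acts on letters, the elements \<open>sigma_desc\<close> and
  \<open>W_elem\<close> are needed as words; \<open>D_eq_word_val\<close> and
  \<open>word_val_W_word\<close> identify the values.\<close>

definition desc_word :: "nat \<Rightarrow> nat \<Rightarrow> braid_gen word" where
  "desc_word n k = map (\<lambda>i. (Sigma_gen i, True)) (rev [k..<n + 1])"

primrec W_word :: "nat \<Rightarrow> W_gen \<Rightarrow> braid_gen word" where
  "W_word n (Tau k) = desc_word n (k + 1) @ [(Sigma_gen k, True), (Sigma_gen k, True)] @ inv_word (desc_word n (k + 1))"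
| "W_word n (Omega r) = desc_word n 1 @ [(A_gen r, True)] @ inv_word (desc_word n 1)"
| "W_word n (Xi j) = desc_word n 1 @ [(Z_gen j, True)] @ inv_word (desc_word n 1)"

text \<open>Each letter \<open>\<sigma>\<^sub>i\<close> meets the index \<open>i + 1\<close> and
  lowers it to \<open>i\<close> without touching \<open>u\<close>.\<close>

lemma fold_step_desc_word:
  assumes "1 \<le> k" "k \<le> n + 1"
  shows "fold step (desc_word n k) (u, n + 1) = (u, k)"
  using assms(2,1)
proof (induction rule: inc_induct)
  case (step k)
  hence "[k..<n + 1] = k # [Suc k..<n + 1]" by (simp add: upt_rec del: upt_Suc)
  with step show ?case by (simp add: desc_word_def del: upt_Suc)
qed (simp add: desc_word_def)

lemma fold_step_inv_word:
  assumes "w \<in> lists (braid_gens m g p \<times> UNIV)"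
  shows "fold step (inv_word w) (fold step w s) = s"
  using assms
proof (induction w arbitrary: s)
  case (Cons a w)
  obtain x e where a: "a = (x, e)" by (cases a)
  thus ?case using Cons by (simp add: step_cancel)
qed simp

lemma desc_word_in_lists: "1 \<le> k \<Longrightarrow> desc_word n k \<in> lists (braid_gens (n + 1) g p \<times> UNIV)"
  by (auto simp: desc_word_def braid_gens_def)

lemma inv_word_in_lists: "w \<in> lists (A \<times> UNIV) \<Longrightarrow> inv_word w \<in> lists (A \<times> UNIV)"
  by (auto simp: inv_word_def)

lemma W_word_in_lists:
  "x \<in> W_gens n g p \<Longrightarrow> W_word n x \<in> lists (braid_gens (n + 1) g p \<times> UNIV)"
proof -
  assume x: "x \<in> W_gens n g p"
  have "Sigma_gen k \<in> braid_gens (n + 1) g p" if "x = Tau k" for k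
    using x that by (auto simp: W_gens_def braid_gens_def)
  moreover have "A_gen r \<in> braid_gens (n + 1) g p" if "x = Omega r" for r
    using x that by (auto simp: W_gens_def braid_gens_def)
  moreover have "Z_gen j \<in> braid_gens (n + 1) g p" if "x = Xi j" for j
    using x that by (auto simp: W_gens_def braid_gens_def)
  ultimately show ?thesis
    by (cases x) (simp_all add: desc_word_in_lists[simplified] inv_word_in_lists)
qed

text \<open>The descending word leads to the index at which the middle part acts by a translation:
  \<open>\<sigma>\<^sub>k \<sigma>\<^sub>k\<close> goes from \<open>k + 1\<close> to
  \<open>k\<close> and back and leaves \<open>T k\<close> behind, while \<open>a\<^sub>r\<close> and
  \<open>z\<^sub>j\<close> act at index \<open>1\<close>. The inverse word climbs back to
  \<open>n + 1\<close>.\<close>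

lemma fold_step_W_word:
  assumes "x \<in> W_gens n g p"
  shows "fold step (W_word n x) (u, n + 1) = (u + gen x, n + 1)"
proof -
  have inv: "fold step (inv_word (desc_word n k)) (v, k) = (v, n + 1)" if "1 \<le> k" "k \<le> n + 1" for k v
    using fold_step_inv_word[OF desc_word_in_lists[OF that(1)], of n "(v, n + 1)"]
      fold_step_desc_word[OF that, of v] by simp
  show ?thesis
    using assms fold_step_desc_word[of _ n u] inv
    by (cases x) (auto simp: W_gens_def)
qed

primrec W_letter_word :: "nat \<Rightarrow> W_gen \<times> bool \<Rightarrow> braid_gen word" where
  "W_letter_word n (x, e) = (if e then W_word n x else inv_word (W_word n x))"

lemma fold_step_W_letter_words:
  assumes "w \<in> lists (W_gens n g p \<times> UNIV)"
  shows "fold step (concat (map (W_letter_word n) w)) (u, n + 1) = (u + word_sum gen w, n + 1)"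
  using assms
proof (induction w arbitrary: u)
  case (Cons a w)
  obtain x e where a: "a = (x, e)" by (cases a)
  with Cons have x: "x \<in> W_gens n g p" by auto
  \<comment> \<open>The inverse word undoes the move from \<open>u + - gen x\<close> to
    \<open>u\<close>.\<close>
  have "fold step (inv_word (W_word n x)) (u, n + 1) = (u + - gen x, n + 1)"
    using fold_step_inv_word[OF W_word_in_lists[OF x], of "(u + - gen x, n + 1)"]
    by (simp add: fold_step_W_word[OF x, simplified] add.assoc)
  with Cons fold_step_W_word[OF x] show ?case
    by (simp add: a group_add_normalize del: add_uminus_conv_diff)
qed simp

text \<open>Applied to \<open>(0, n + 1)\<close>, each word leaves its own value in \<open>F\<close>
  in the first component.\<close>

lemma pres_eq_W_letter_words:
  assumes "u \<in> lists (W_gens n g p \<times> UNIV)" "v \<in> lists (W_gens n g p \<times> UNIV)"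
    and "pres_eq (braid_gens m g p) (braid_rels m g p)
           (concat (map (W_letter_word n) u)) (concat (map (W_letter_word n) v))"
  shows "pres_eq (W_gens n g p) {} u v"
proof -
  have "(0 + word_sum gen u, n + 1) = (0 + word_sum gen v, n + 1)"
    using assms by (metis fold_step_W_letter_words fold_step_pres_eq)
  hence "word_sum gen u = word_sum gen v" by simp
  thus ?thesis
    using assms(1,2) by (auto simp: word_sum_gen_eq_iff intro: pres_eq_restrict_alphabet)
qed

section \<open>Conjugation in groups\<close>

context group
begin

lemma inv_l_cancel [simp]: "x \<in> carrier G \<Longrightarrow> y \<in> carrier G \<Longrightarrow> inv x \<otimes> (x \<otimes> y) = y"
  by (simp flip: m_assoc)

lemma inv_r_cancel [simp]: "x \<in> carrier G \<Longrightarrow> y \<in> carrier G \<Longrightarrow> x \<otimes> (inv x \<otimes> y) = y"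
  by (simp flip: m_assoc)

lemma conj_by_closed [simp]: "x \<in> carrier G \<Longrightarrow> b \<in> carrier G \<Longrightarrow> conj_by G x b \<in> carrier G"
  by (simp add: conj_by_def)

lemma conj_by_one_left [simp]: "b \<in> carrier G \<Longrightarrow> conj_by G \<one> b = \<one>"
  by (simp add: conj_by_def)

lemma conj_by_one_right [simp]: "x \<in> carrier G \<Longrightarrow> conj_by G x \<one> = x"
  by (simp add: conj_by_def)

lemma conj_by_mult:
  "x \<in> carrier G \<Longrightarrow> y \<in> carrier G \<Longrightarrow> b \<in> carrier G \<Longrightarrow>
   conj_by G (x \<otimes> y) b = conj_by G x b \<otimes> conj_by G y b"
  by (simp add: conj_by_def m_assoc)

lemma conj_by_inv:
  "x \<in> carrier G \<Longrightarrow> b \<in> carrier G \<Longrightarrow> conj_by G (inv x) b = inv (conj_by G x b)"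
  by (simp add: conj_by_def m_assoc inv_mult_group)

lemma conj_by_conj_by:
  "x \<in> carrier G \<Longrightarrow> b \<in> carrier G \<Longrightarrow> c \<in> carrier G \<Longrightarrow>
   conj_by G (conj_by G x b) c = conj_by G x (b \<otimes> c)"
  by (simp add: conj_by_def m_assoc inv_mult_group)

lemma conj_by_eqI:
  assumes "x \<otimes> b = b \<otimes> y" "x \<in> carrier G" "b \<in> carrier G" "y \<in> carrier G"
  shows "conj_by G x b = y"
  using assms by (simp add: conj_by_def m_assoc)

lemma conj_by_fixed:
  "x \<otimes> b = b \<otimes> x \<Longrightarrow> x \<in> carrier G \<Longrightarrow> b \<in> carrier G \<Longrightarrow> conj_by G x b = x"
  by (rule conj_by_eqI)

lemma commute_mult:
  assumes "x \<otimes> b = b \<otimes> x" "x \<otimes> c = c \<otimes> x" "x \<in> carrier G" "b \<in> carrier G" "c \<in> carrier G"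
  shows "x \<otimes> (b \<otimes> c) = (b \<otimes> c) \<otimes> x"
  using assms by (metis m_assoc)

lemma commute_inv:
  assumes "x \<otimes> b = b \<otimes> x" "x \<in> carrier G" "b \<in> carrier G"
  shows "x \<otimes> inv b = inv b \<otimes> x"
  using assms by (metis inv_closed inv_solve_left inv_solve_right' m_assoc m_closed)

lemma conj_by_swap:
  assumes "x \<in> carrier G" "b \<in> carrier G" "c \<in> carrier G" "b \<otimes> c = c \<otimes> b"
  shows "conj_by G (conj_by G x b) c = conj_by G (conj_by G x c) b"
  using assms by (simp add: conj_by_conj_by)

lemma conj_by_conj_by_conj_by:
  assumes "x \<in> carrier G" "b \<in> carrier G" "c \<in> carrier G"
  shows "conj_by G (conj_by G x b) c = conj_by G (conj_by G x c) (conj_by G b c)"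
  using assms by (simp add: conj_by_def m_assoc inv_mult_group)

subsection \<open>Two-strand identities\<close>

text \<open>Put \<open>q = t s t\<inverse>\<close>. Then \<open>s q = q t = t s\<close>, so
  conjugation by \<open>q\<inverse>\<close> carries \<open>t\<close> to \<open>s\<close>; it carries
  \<open>s\<close> to \<open>q^s\<close>, because \<open>s\<close> and \<open>q\<close> again
  satisfy the braid relation. The claims are these facts for squares. Up to a common conjugator,
  \<open>q\<^sup>2\<close> and \<open>t\<^sup>2\<close> will be \<open>\<tau>\<^sub>i\<close> and
  \<open>\<tau>\<^sub>i\<^sub>+\<^sub>1\<close>.\<close>

lemma braid_conj:
  assumes s: "s \<in> carrier G" and t: "t \<in> carrier G" and st: "s \<otimes> t \<otimes> s = t \<otimes> s \<otimes> t"
  shows "conj_by G (t \<otimes> t) s = conj_by G (s \<otimes> s) (inv t)"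
    and "conj_by G (conj_by G (s \<otimes> s) (inv t)) s = conj_by G (t \<otimes> t) (inv (conj_by G (s \<otimes> s) (inv t)))"
proof -
  note [simp] = s t
  have st': "s \<otimes> (t \<otimes> s) = t \<otimes> (s \<otimes> t)" using st by (simp add: m_assoc)
  have st'': "s \<otimes> (t \<otimes> (s \<otimes> x)) = t \<otimes> (s \<otimes> (t \<otimes> x))" if "x \<in> carrier G" for x
    using that st by (metis m_assoc m_closed s t)
  have 1: "conj_by G t s = conj_by G s (inv t)"
    by (rule conj_by_eqI) (simp_all add: conj_by_def m_assoc st'')
  show 2: "conj_by G (t \<otimes> t) s = conj_by G (s \<otimes> s) (inv t)"
    by (simp add: conj_by_mult 1)
  define q where "q = conj_by G s (inv t)"
  have [simp]: "q \<in> carrier G" by (simp add: q_def)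
  have sq: "s \<otimes> q = t \<otimes> s" and qt: "q \<otimes> t = t \<otimes> s"
    by (simp_all add: q_def conj_by_def m_assoc, simp add: st'')
  have "s \<otimes> (q \<otimes> s) = s \<otimes> q \<otimes> s" by (simp add: m_assoc)
  also have "\<dots> = q \<otimes> t \<otimes> s" by (simp only: sq qt)
  also have "\<dots> = q \<otimes> (s \<otimes> q)" by (simp add: m_assoc sq)
  finally have sqs: "s \<otimes> (q \<otimes> s) = q \<otimes> (s \<otimes> q)" .
  have "conj_by G t (inv (q \<otimes> q)) = conj_by G (conj_by G t (inv q)) (inv q)"
    by (simp add: conj_by_conj_by inv_mult_group)
  also have "conj_by G t (inv q) = s"
  proof -
    have "q \<otimes> t \<otimes> inv q = s \<otimes> q \<otimes> inv q" by (simp add: qt sq)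
    thus ?thesis by (simp add: conj_by_def m_assoc)
  qed
  also have "conj_by G s (inv q) = conj_by G q s"
  proof (rule conj_by_eqI[symmetric])
    have "s \<otimes> (q \<otimes> s) \<otimes> inv q = q \<otimes> s" by (subst sqs) (simp add: m_assoc)
    thus "q \<otimes> s = s \<otimes> conj_by G s (inv q)" by (simp add: conj_by_def m_assoc)
  qed simp_all
  finally have "conj_by G q s = conj_by G t (inv (q \<otimes> q))" by simp
  thus "conj_by G (conj_by G (s \<otimes> s) (inv t)) s = conj_by G (t \<otimes> t) (inv (conj_by G (s \<otimes> s) (inv t)))"
    by (simp add: conj_by_mult flip: q_def)
qed

text \<open>For \<open>q = a s\<inverse> a\<close> the relation reads
  \<open>s\<inverse> q = q s\<close>: conjugation by \<open>q\<close> inverts \<open>s\<close>, and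
  so conjugation by \<open>v a = s q\<close> inverts \<open>t\<close>. The first formula is
  \<open>v a = s q = q s\<inverse> = a t\<inverse> v\<close>. For the second, \<open>t^a\<close> is
  the conjugate of \<open>t\<inverse>\<close> by \<open>(v a)\<inverse> a\<close>, which is the
  inverse of \<open>v^a\<close>.\<close>

lemma crosscap_conj:
  assumes s: "s \<in> carrier G" and a: "a \<in> carrier G"
    and rel: "inv s \<otimes> a \<otimes> inv s \<otimes> a = a \<otimes> inv s \<otimes> a \<otimes> s"
  defines "t \<equiv> s \<otimes> s" and "v \<equiv> conj_by G a (inv s)"
  shows "conj_by G v a = inv t \<otimes> v"
    and "conj_by G t a = conj_by G (inv t) (inv v \<otimes> t)"
proof -
  note [simp] = s a
  define q where "q = a \<otimes> inv s \<otimes> a"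
  have [simp]: "q \<in> carrier G" "t \<in> carrier G" "v \<in> carrier G"
    by (simp_all add: q_def t_def v_def)
  have q: "inv s \<otimes> q = q \<otimes> s"
    using rel by (simp add: q_def m_assoc)
  have q': "s \<otimes> q = q \<otimes> inv s"
    by (metis q \<open>q \<in> carrier G\<close> inv_closed inv_r_cancel inv_solve_right m_assoc m_closed s)
  have va: "v \<otimes> a = s \<otimes> q" and tv: "inv t \<otimes> v = inv s \<otimes> a \<otimes> inv s"
    by (simp_all add: v_def t_def conj_by_def q_def m_assoc inv_mult_group)
  show 1: "conj_by G v a = inv t \<otimes> v"
    by (rule conj_by_eqI) (simp_all add: va q' tv, simp_all add: q_def m_assoc)
  have "inv t \<otimes> q = q \<otimes> t"
    by (metis q \<open>q \<in> carrier G\<close> inv_closed inv_mult_group m_assoc s t_def)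
  hence "t \<otimes> q = q \<otimes> inv t"
    by (metis \<open>q \<in> carrier G\<close> \<open>t \<in> carrier G\<close> inv_closed inv_r_cancel inv_solve_right m_assoc m_closed)
  hence tq: "t \<otimes> (s \<otimes> q) = s \<otimes> q \<otimes> inv t"
    by (simp add: t_def m_assoc)
  have "conj_by G (inv t) (inv (v \<otimes> a)) = t"
    unfolding va using tq by (simp add: conj_by_def m_assoc inv_mult_group flip: tq)
  hence "conj_by G t a = conj_by G (conj_by G (inv t) (inv (v \<otimes> a))) a"
    by simp
  also have "\<dots> = conj_by G (inv t) (inv (conj_by G v a))"
    by (simp add: conj_by_conj_by) (simp add: conj_by_def m_assoc inv_mult_group)
  finally have "conj_by G t a = conj_by G (inv t) (inv (conj_by G v a))" .
  thus "conj_by G t a = conj_by G (inv t) (inv v \<otimes> t)"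
    by (simp add: 1 inv_mult_group)
qed

text \<open>Writing \<open>t\<close> for \<open>s\<^sup>2\<close>, the element \<open>c\<^bsup>s\<inverse>\<^esup>\<close> is the conjugate by \<open>t\<inverse>\<close> of \<open>c\<^bsup>s\<^esup>\<close>, which commutes with \<open>x\<close>.\<close>

lemma conj_by_commute_shift:
  assumes s: "s \<in> carrier G" and c: "c \<in> carrier G" and x: "x \<in> carrier G"
    and rel: "inv s \<otimes> c \<otimes> s \<otimes> x = x \<otimes> (inv s \<otimes> c \<otimes> s)"
  defines "t \<equiv> s \<otimes> s" and "v \<equiv> conj_by G c (inv s)"
  shows "conj_by G v x = conj_by G v (t \<otimes> inv (conj_by G t x))"
proof -
  note [simp] = s c x
  have b: "conj_by G (conj_by G c s) x = conj_by G c s"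
    by (rule conj_by_fixed) (use rel in \<open>simp_all add: conj_by_def\<close>)
  have "conj_by G v x = conj_by G (conj_by G (conj_by G c s) (inv t)) x"
    by (simp add: v_def t_def conj_by_conj_by inv_mult_group)
  also have "\<dots> = conj_by G (conj_by G c s) (conj_by G (inv t) x)"
    by (subst conj_by_conj_by_conj_by) (simp_all add: b t_def)
  also have "\<dots> = conj_by G v (t \<otimes> inv (conj_by G t x))"
    by (simp add: v_def t_def conj_by_conj_by inv_mult_group m_assoc flip: conj_by_inv)
  finally show ?thesis .
qed

text \<open>Conjugation by \<open>s\<inverse>\<close> carries the commuting pair \<open>c\<close>,
  \<open>x^s\<close> to the pair \<open>c^(s\<inverse>)\<close>, \<open>x\<close>.\<close>

lemma commute_shift:
  assumes s: "s \<in> carrier G" and c: "c \<in> carrier G" and x: "x \<in> carrier G"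
    and rel: "inv s \<otimes> x \<otimes> s \<otimes> c = c \<otimes> (inv s \<otimes> x \<otimes> s)"
  shows "conj_by G (conj_by G c (inv s)) x = conj_by G c (inv s)"
proof -
  note [simp] = s c x
  have "conj_by G c (conj_by G x s) = c"
    by (rule conj_by_fixed) (use rel in \<open>simp_all add: conj_by_def\<close>)
  hence "conj_by G (conj_by G c (conj_by G x s)) (inv s) = conj_by G c (inv s)"
    by simp
  thus ?thesis
    by (simp add: conj_by_def m_assoc inv_mult_group)
qed

text \<open>For \<open>y = s\<inverse> z s\<inverse>\<close> the relation says that \<open>y\<close>
  and \<open>z\<close> commute, and \<open>v = t y\<close>. Then \<open>s\<close>, hence
  \<open>t\<close>, commutes with \<open>z y\<close>, so \<open>z\<close> acts on \<open>t\<close>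
  as \<open>y\<inverse>\<close> does. Finally
  \<open>v^z = t^(y\<inverse>) y = y t = v^t\<close>.\<close>

lemma boundary_conj:
  assumes s: "s \<in> carrier G" and z: "z \<in> carrier G"
    and rel: "inv s \<otimes> z \<otimes> inv s \<otimes> z = z \<otimes> (inv s \<otimes> z \<otimes> inv s)"
  defines "t \<equiv> s \<otimes> s" and "v \<equiv> conj_by G z (inv s)"
  shows "conj_by G t z = commutator G t (inv v) \<otimes> t"
    and "conj_by G v z = conj_by G v t"
proof -
  note [simp] = s z
  define y where "y = inv s \<otimes> z \<otimes> inv s"
  have [simp]: "y \<in> carrier G" "t \<in> carrier G" "v \<in> carrier G"
    by (simp_all add: y_def t_def v_def)
  have yz: "y \<otimes> z = z \<otimes> y" using rel by (simp add: y_def m_assoc)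
  have v: "v = t \<otimes> y"
    by (simp add: v_def t_def y_def conj_by_def m_assoc)
  have "s \<otimes> (z \<otimes> y) = z \<otimes> y \<otimes> s"
    by (subst yz[symmetric]) (simp add: y_def m_assoc)
  hence "t \<otimes> (z \<otimes> y) = z \<otimes> y \<otimes> t"
    unfolding t_def by (metis \<open>y \<in> carrier G\<close> m_assoc m_closed s z)
  hence "conj_by G t (z \<otimes> y) = t"
    by (simp add: conj_by_fixed)
  hence "conj_by G (conj_by G t (z \<otimes> y)) (inv y) = conj_by G t (inv y)"
    by simp
  hence 1: "conj_by G t z = conj_by G t (inv y)"
    by (simp add: conj_by_conj_by m_assoc)
  also have "\<dots> = commutator G t (inv v) \<otimes> t"
    by (simp add: v commutator_def conj_by_def m_assoc inv_mult_group)
  finally show "conj_by G t z = commutator G t (inv v) \<otimes> t" .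
  have "conj_by G v z = conj_by G t (inv y) \<otimes> y"
    by (simp add: v conj_by_mult 1 conj_by_fixed yz)
  also have "\<dots> = conj_by G v t"
    by (simp add: v conj_by_def m_assoc)
  finally show "conj_by G v z = conj_by G v t" .
qed

subsection \<open>Left conjugation\<close>

text \<open>The elements \<open>W_elem\<close> have this shape, with a descending product as
  \<open>d\<close>. The lemmas below move an outer conjugation past \<open>d\<close>.\<close>

definition shift :: "'a \<Rightarrow> 'a \<Rightarrow> 'a" where
  "shift d x = d \<otimes> x \<otimes> inv d"

lemma shift_eq_conj_by: "d \<in> carrier G \<Longrightarrow> shift d x = conj_by G x (inv d)"
  by (simp add: shift_def conj_by_def)

lemma shift_closed [simp]: "d \<in> carrier G \<Longrightarrow> x \<in> carrier G \<Longrightarrow> shift d x \<in> carrier G"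
  by (simp add: shift_def)

lemma shift_mult:
  "d \<in> carrier G \<Longrightarrow> x \<in> carrier G \<Longrightarrow> y \<in> carrier G \<Longrightarrow> shift d (x \<otimes> y) = shift d x \<otimes> shift d y"
  by (simp add: shift_eq_conj_by conj_by_mult)

lemma shift_inv: "d \<in> carrier G \<Longrightarrow> x \<in> carrier G \<Longrightarrow> shift d (inv x) = inv (shift d x)"
  by (simp add: shift_eq_conj_by conj_by_inv)

lemma shift_conj_by:
  "d \<in> carrier G \<Longrightarrow> x \<in> carrier G \<Longrightarrow> y \<in> carrier G \<Longrightarrow>
   shift d (conj_by G x y) = conj_by G (shift d x) (shift d y)"
  using conj_by_conj_by_conj_by[of x y "inv d"] by (simp add: shift_eq_conj_by)

lemma shift_commutator:
  "d \<in> carrier G \<Longrightarrow> x \<in> carrier G \<Longrightarrow> y \<in> carrier G \<Longrightarrow>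
   shift d (commutator G x y) = commutator G (shift d x) (shift d y)"
  by (simp add: commutator_def shift_mult shift_inv)

lemma shift_shift:
  "d \<in> carrier G \<Longrightarrow> e \<in> carrier G \<Longrightarrow> x \<in> carrier G \<Longrightarrow> shift d (shift e x) = shift (d \<otimes> e) x"
  by (simp add: shift_def m_assoc inv_mult_group)

lemma conj_by_shift:
  assumes "d \<in> carrier G" "x \<in> carrier G" "y \<in> carrier G" "y \<otimes> d = d \<otimes> y"
  shows "conj_by G (shift d x) y = shift d (conj_by G x y)"
  using assms commute_inv[OF assms(4)] by (simp add: shift_eq_conj_by conj_by_swap)

text \<open>For a \<open>y\<close> that turns into another element on passing \<open>d\<close>, as
  \<open>\<sigma>\<^sub>i\<close> turns into \<open>\<sigma>\<^sub>i\<^sub>+\<^sub>1\<close> in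
  \<open>s_D_shift\<close>.\<close>

lemma conj_by_shift_transport:
  assumes "d \<in> carrier G" "x \<in> carrier G" "y \<in> carrier G" "y' \<in> carrier G" "y \<otimes> d = d \<otimes> y'"
  shows "conj_by G (shift d x) y = shift d (conj_by G x y')"
proof -
  have "inv d \<otimes> y = y' \<otimes> inv d"
    using assms by (metis inv_closed inv_solve_left inv_solve_right m_assoc m_closed)
  thus ?thesis
    using assms by (simp add: shift_eq_conj_by conj_by_conj_by)
qed

subsection \<open>Values of words\<close>

lemma word_val_Nil [simp]: "word_val G f [] = \<one>"
  by (simp add: word_val_def)

lemma word_val_Cons [simp]:
  "word_val G f ((x, e) # w) = (if e then f x else inv (f x)) \<otimes> word_val G f w"
  by (simp add: word_val_def)

lemma word_val_closed:
  assumes "f ` A \<subseteq> carrier G" "w \<in> lists (A \<times> UNIV)"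
  shows "word_val G f w \<in> carrier G"
  using assms(2,1) by (induction w) auto

lemma word_val_append:
  assumes "f ` A \<subseteq> carrier G" "u \<in> lists (A \<times> UNIV)" "v \<in> lists (A \<times> UNIV)"
  shows "word_val G f (u @ v) = word_val G f u \<otimes> word_val G f v"
  using assms(2,1,3)
proof (induction u)
  case (Cons a u)
  obtain x e where a: "a = (x, e)" by (cases a)
  have "f x \<in> carrier G" using Cons a by auto
  with Cons show ?case
    by (auto simp: a m_assoc word_val_closed)
qed (simp add: word_val_closed)

lemma word_val_inv_word:
  assumes "f ` A \<subseteq> carrier G" "w \<in> lists (A \<times> UNIV)"
  shows "word_val G f (inv_word w) = inv (word_val G f w)"
  using assms(2,1)
proof (induction w)
  case (Cons a w)
  obtain x e where a: "a = (x, e)" by (cases a)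
  have [simp]: "f x \<in> carrier G" "word_val G f w \<in> carrier G"
    using Cons a by (auto intro: word_val_closed)
  have "word_val G f (inv_word w @ [(x, \<not> e)]) = word_val G f (inv_word w) \<otimes> word_val G f [(x, \<not> e)]"
    using Cons a by (intro word_val_append[of f A]) (auto simp: inv_word_def)
  with Cons show ?case
    by (simp add: a inv_mult_group)
qed simp

lemma word_val_pres_eq:
  assumes "pres_eq A {} u v" and A: "f ` A \<subseteq> carrier G"
    and "u \<in> lists (A \<times> UNIV)" "v \<in> lists (A \<times> UNIV)"
  shows "word_val G f u = word_val G f v"
proof -
  \<comment> \<open>The intermediate words of a derivation may contain letters outside \<open>A\<close>, where \<open>f\<close> may leave the group.\<close>
  define h where "h x = (if x \<in> A then f x else \<one>)" for x
  have h: "h ` UNIV \<subseteq> carrier G" using A by (auto simp: h_def)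
  have "word_val G h u = word_val G h v"
    using assms(1)
  proof induction
    case (cong u v s t)
    thus ?case by (simp add: word_val_append[OF h])
  next
    case (cancel x e)
    have "h x \<in> carrier G" using h by auto
    thus ?case by simp
  qed auto
  moreover have "word_val G h w = word_val G f w" if "w \<in> lists (A \<times> UNIV)" for w
    using that by (induction w) (auto simp: h_def)
  ultimately show ?thesis using assms by metis
qed

end

section \<open>The conjugation formulas\<close>

text \<open>The conjugation formulas follow from the validity of the relations alone; their
  completeness enters in \<open>W_free\<close>, as a separate hypothesis.\<close>

locale surface_braid = group G for G (structure) +
  fixes f :: "braid_gen \<Rightarrow> 'a" and n g p :: nat
  assumes n_gt_1: "n > 1"
    and gens_closed: "f ` braid_gens (n + 1) g p \<subseteq> carrier G"
    and rels: "(u, v) \<in> braid_rels (n + 1) g p \<Longrightarrow> word_val G f u = word_val G f v"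
begin

abbreviation "s i \<equiv> f (Sigma_gen i)"
abbreviation "a r \<equiv> f (A_gen r)"
abbreviation "z j \<equiv> f (Z_gen j)"
abbreviation "D k \<equiv> sigma_desc G f n k"
abbreviation "\<tau> k \<equiv> W_elem G f n (Tau k)"
abbreviation "w r \<equiv> W_elem G f n (Omega r)"
abbreviation "\<xi> j \<equiv> W_elem G f n (Xi j)"
abbreviation "W \<equiv> generate G (W_elem G f n ` W_gens n g p)"

lemma s_closed: "1 \<le> i \<Longrightarrow> i \<le> n \<Longrightarrow> s i \<in> carrier G"
  and a_closed: "1 \<le> r \<Longrightarrow> r \<le> g \<Longrightarrow> a r \<in> carrier G"
  and z_closed: "1 \<le> j \<Longrightarrow> j \<le> p - 1 \<Longrightarrow> z j \<in> carrier G"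
  using gens_closed by (auto simp: braid_gens_def image_subset_iff)

lemmas closed = s_closed a_closed z_closed

section \<open>The defining relations as identities in the group\<close>

lemma s_braid: "1 \<le> i \<Longrightarrow> i < n \<Longrightarrow> s i \<otimes> s (Suc i) \<otimes> s i = s (Suc i) \<otimes> s i \<otimes> s (Suc i)"
  using rels[of "[(Sigma_gen i, True), (Sigma_gen (Suc i), True), (Sigma_gen i, True)]"
      "[(Sigma_gen (Suc i), True), (Sigma_gen i, True), (Sigma_gen (Suc i), True)]"]
  by (simp add: braid_rels_def pos_def neg_def closed m_assoc)

lemma s_commute:
  "1 \<le> i \<Longrightarrow> i \<le> n \<Longrightarrow> 1 \<le> j \<Longrightarrow> j \<le> n \<Longrightarrow> Suc i < j \<or> Suc j < i \<Longrightarrow> s i \<otimes> s j = s j \<otimes> s i"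
  using rels[of "[(Sigma_gen i, True), (Sigma_gen j, True)]" "[(Sigma_gen j, True), (Sigma_gen i, True)]"]
  by (auto simp add: braid_rels_def pos_def neg_def closed)

lemma a_s_commute:
  "1 \<le> r \<Longrightarrow> r \<le> g \<Longrightarrow> 1 < i \<Longrightarrow> i \<le> n \<Longrightarrow> a r \<otimes> s i = s i \<otimes> a r"
  using rels[of "[(A_gen r, True), (Sigma_gen i, True)]" "[(Sigma_gen i, True), (A_gen r, True)]"]
  by (auto simp add: braid_rels_def pos_def neg_def closed)

lemma z_s_commute:
  "1 \<le> j \<Longrightarrow> j \<le> p - 1 \<Longrightarrow> 1 < i \<Longrightarrow> i \<le> n \<Longrightarrow> z j \<otimes> s i = s i \<otimes> z j"
  using rels[of "[(Z_gen j, True), (Sigma_gen i, True)]" "[(Sigma_gen i, True), (Z_gen j, True)]"]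
  by (auto simp add: braid_rels_def pos_def neg_def closed)

lemma a_a:
  assumes "1 \<le> r" "r \<le> g"
  shows "inv (s 1) \<otimes> a r \<otimes> inv (s 1) \<otimes> a r = a r \<otimes> inv (s 1) \<otimes> a r \<otimes> s 1"
proof -
  have "([(Sigma_gen 1, False), (A_gen r, True), (Sigma_gen 1, False), (A_gen r, True)],
         [(A_gen r, True), (Sigma_gen 1, False), (A_gen r, True), (Sigma_gen 1, True)])
        \<in> braid_rels (n + 1) g p"
    using assms by (simp add: braid_rels_def pos_def neg_def)
  from rels[OF this] show ?thesis
    using assms n_gt_1 closed[of 1] a_closed[of r] by (simp add: m_assoc)
qed

lemma a_a_commute:
  assumes "1 \<le> t" "t < r" "r \<le> g"
  shows "inv (s 1) \<otimes> a t \<otimes> s 1 \<otimes> a r = a r \<otimes> (inv (s 1) \<otimes> a t \<otimes> s 1)"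
proof -
  have "([(Sigma_gen 1, False), (A_gen t, True), (Sigma_gen 1, True), (A_gen r, True)],
         [(A_gen r, True), (Sigma_gen 1, False), (A_gen t, True), (Sigma_gen 1, True)])
        \<in> braid_rels (n + 1) g p"
    using assms by (simp add: braid_rels_def pos_def neg_def)
  from rels[OF this] show ?thesis
    using assms n_gt_1 s_closed[of 1] a_closed[of r] a_closed[of t] by (simp add: m_assoc)
qed

lemma z_a_commute:
  assumes "1 \<le> j" "j \<le> p - 1" "1 \<le> r" "r \<le> g"
  shows "inv (s 1) \<otimes> z j \<otimes> s 1 \<otimes> a r = a r \<otimes> (inv (s 1) \<otimes> z j \<otimes> s 1)"
proof -
  have "([(Sigma_gen 1, False), (Z_gen j, True), (Sigma_gen 1, True), (A_gen r, True)],
         [(A_gen r, True), (Sigma_gen 1, False), (Z_gen j, True), (Sigma_gen 1, True)])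
        \<in> braid_rels (n + 1) g p"
    using assms by (simp add: braid_rels_def pos_def neg_def)
  from rels[OF this] show ?thesis
    using assms n_gt_1 s_closed[of 1] a_closed[of r] z_closed[of j] by (simp add: m_assoc)
qed

lemma z_z_commute:
  assumes "1 \<le> j" "j < l" "l \<le> p - 1"
  shows "inv (s 1) \<otimes> z j \<otimes> s 1 \<otimes> z l = z l \<otimes> (inv (s 1) \<otimes> z j \<otimes> s 1)"
proof -
  have "([(Sigma_gen 1, False), (Z_gen j, True), (Sigma_gen 1, True), (Z_gen l, True)],
         [(Z_gen l, True), (Sigma_gen 1, False), (Z_gen j, True), (Sigma_gen 1, True)])
        \<in> braid_rels (n + 1) g p"
    using assms by (simp add: braid_rels_def pos_def neg_def)
  from rels[OF this] show ?thesis
    using assms n_gt_1 s_closed[of 1] z_closed[of l] z_closed[of j] by (simp add: m_assoc)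
qed

lemma z_z:
  assumes "1 \<le> j" "j \<le> p - 1"
  shows "inv (s 1) \<otimes> z j \<otimes> inv (s 1) \<otimes> z j = z j \<otimes> (inv (s 1) \<otimes> z j \<otimes> inv (s 1))"
proof -
  have "([(Sigma_gen 1, False), (Z_gen j, True), (Sigma_gen 1, False), (Z_gen j, True)],
         [(Z_gen j, True), (Sigma_gen 1, False), (Z_gen j, True), (Sigma_gen 1, False)])
        \<in> braid_rels (n + 1) g p"
    using assms by (simp add: braid_rels_def pos_def neg_def)
  from rels[OF this] show ?thesis
    using assms n_gt_1 s_closed[of 1] z_closed[of j] by (simp add: m_assoc)
qed

section \<open>Descending products of the braid generators\<close>

lemma D_eq_word_val: "D k = word_val G f (desc_word n k)"
  by (simp add: sigma_desc_def desc_word_def)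

lemma D_closed: "1 \<le> k \<Longrightarrow> D k \<in> carrier G"
  unfolding D_eq_word_val by (intro word_val_closed[OF gens_closed] desc_word_in_lists)

lemma D_top: "D (Suc n) = \<one>"
  by (simp add: sigma_desc_def)

lemma D_step:
  assumes "1 \<le> k" "k \<le> n"
  shows "D k = D (Suc k) \<otimes> s k"
proof -
  have "desc_word n k = desc_word n (Suc k) @ [(Sigma_gen k, True)]"
    using assms by (simp add: desc_word_def upt_rec[of k] del: upt_Suc)
  moreover have "[(Sigma_gen k, True)] \<in> lists (braid_gens (n + 1) g p \<times> UNIV)"
    using assms by (simp add: braid_gens_def)
  ultimately show ?thesis
    using assms word_val_append[OF gens_closed desc_word_in_lists[of "Suc k"], of "[(Sigma_gen k, True)]"]
    by (simp add: D_eq_word_val closed)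
qed

lemma commute_D:
  assumes x: "x \<in> carrier G" and k: "1 \<le> k" "k \<le> n + 1"
    and comm: "\<And>i. k \<le> i \<Longrightarrow> i \<le> n \<Longrightarrow> x \<otimes> s i = s i \<otimes> x"
  shows "x \<otimes> D k = D k \<otimes> x"
  using k(2,1) comm
proof (induction rule: inc_induct)
  case (step k)
  thus ?case
    by (simp add: D_step commute_mult x D_closed closed)
qed (simp add: D_top x)

text \<open>For \<open>k = i\<close>, \<open>\<sigma>\<^sub>i\<close> passes
  \<open>D (i + 2)\<close>, and the braid relation exchanges it with
  \<open>\<sigma>\<^sub>i\<^sub>+\<^sub>1 \<sigma>\<^sub>i\<close>. Each further factor
  \<open>\<sigma>\<^sub>k\<close> with \<open>k < i\<close> commutes with
  \<open>\<sigma>\<^sub>i\<^sub>+\<^sub>1\<close>.\<close>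

lemma s_D_shift:
  assumes "1 \<le> k" "k \<le> i" "i < n"
  shows "s i \<otimes> D k = D k \<otimes> s (Suc i)"
  using assms(2,1)
proof (induction rule: inc_induct)
  case base
  have D: "D i = D (Suc (Suc i)) \<otimes> s (Suc i) \<otimes> s i"
    using assms base by (simp add: D_step)
  have "s i \<otimes> D (Suc (Suc i)) = D (Suc (Suc i)) \<otimes> s i"
    using assms base by (intro commute_D closed s_commute) auto
  hence "s i \<otimes> D i = D (Suc (Suc i)) \<otimes> (s i \<otimes> s (Suc i) \<otimes> s i)"
    using assms base unfolding D by (simp add: D_closed closed flip: m_assoc)
  thus ?case
    using assms base by (simp add: D s_braid) (simp add: D_closed closed m_assoc)
next
  case (step k)
  have Dk: "D k = D (Suc k) \<otimes> s k" and IH: "s i \<otimes> D (Suc k) = D (Suc k) \<otimes> s (Suc i)"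
    using step assms by (auto intro: D_step)
  have [simp]: "s i \<in> carrier G" "s (Suc i) \<in> carrier G" "s k \<in> carrier G" "D (Suc k) \<in> carrier G"
    using step assms by (auto intro!: closed D_closed)
  have "s i \<otimes> D k = (s i \<otimes> D (Suc k)) \<otimes> s k"
    by (simp add: Dk m_assoc)
  also have "\<dots> = D (Suc k) \<otimes> (s (Suc i) \<otimes> s k)"
    unfolding IH by (simp add: m_assoc)
  also have "s (Suc i) \<otimes> s k = s k \<otimes> s (Suc i)"
    using step assms by (intro s_commute) auto
  also have "D (Suc k) \<otimes> (s k \<otimes> s (Suc i)) = D k \<otimes> s (Suc i)"
    by (simp add: Dk m_assoc)
  finally show ?case .
qed

lemma tau_eq_shift: "1 \<le> k \<Longrightarrow> k \<le> n \<Longrightarrow> \<tau> k = shift (D (Suc k)) (s k \<otimes> s k)"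
  by (simp add: shift_def closed numeral_2_eq_2)

lemma w_eq_shift: "w r = shift (D 1) (a r)"
  and xi_eq_shift: "\<xi> j = shift (D 1) (z j)"
  by (simp_all add: shift_def)

text \<open>Splits off the last factor of \<open>D 1\<close>: the generators
  \<open>a\<^sub>r\<close> and \<open>z\<^sub>j\<close> commute with \<open>D 2\<close>, so only
  \<open>\<sigma>\<^sub>1\<close> has to be dealt with.\<close>

lemma shift_D_1:
  assumes "x \<in> carrier G"
  shows "shift (D 1) x = shift (D 2) (conj_by G x (inv (s 1)))"
  using assms n_gt_1 D_step[of 1] D_closed[of 2] s_closed[of 1]
  by (simp add: numeral_2_eq_2 shift_eq_conj_by conj_by_conj_by inv_mult_group)

lemma tau_1: "\<tau> 1 = shift (D 2) (s 1 \<otimes> s 1)"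
  using tau_eq_shift[of 1] n_gt_1 by (simp add: numeral_2_eq_2)

lemma tau_closed: "1 \<le> k \<Longrightarrow> k \<le> n \<Longrightarrow> \<tau> k \<in> carrier G"
  by (simp only: tau_eq_shift shift_closed D_closed closed m_closed)

lemma w_closed: "1 \<le> r \<Longrightarrow> r \<le> g \<Longrightarrow> w r \<in> carrier G"
  by (simp only: w_eq_shift shift_closed D_closed closed)

lemma xi_closed: "1 \<le> j \<Longrightarrow> j \<le> p - 1 \<Longrightarrow> \<xi> j \<in> carrier G"
  by (simp only: xi_eq_shift shift_closed D_closed closed)

lemma sigma_conj:
  assumes i: "1 \<le> i" "i < n"
  shows "conj_by G (\<tau> i) (s i) = conj_by G (\<tau> (Suc i)) (inv (\<tau> i))"
    and "conj_by G (\<tau> (Suc i)) (s i) = \<tau> i"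
    and "\<And>l. 1 \<le> l \<Longrightarrow> l \<le> n \<Longrightarrow> l \<noteq> i \<Longrightarrow> l \<noteq> Suc i \<Longrightarrow> conj_by G (\<tau> l) (s i) = \<tau> l"
    and "\<And>r. 1 \<le> r \<Longrightarrow> r \<le> g \<Longrightarrow> conj_by G (w r) (s i) = w r"
    and "\<And>j. 1 \<le> j \<Longrightarrow> j \<le> p - 1 \<Longrightarrow> conj_by G (\<xi> j) (s i) = \<xi> j"
proof -
  \<comment> \<open>The common conjugator of \<open>\<tau>\<^sub>i\<close> and
    \<open>\<tau>\<^sub>i\<^sub>+\<^sub>1\<close>; the additional factor
    \<open>\<sigma>\<^sub>i\<^sub>+\<^sub>1\<close> in \<open>\<tau>\<^sub>i\<close> is absorbed
    into \<open>q\<close>. For \<open>i = n - 1\<close> it is the empty product.\<close>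
  define E where "E = D (Suc (Suc i))"
  have [simp]: "E \<in> carrier G" "s i \<in> carrier G" "s (Suc i) \<in> carrier G"
    using i by (simp_all add: E_def D_closed closed)
  have sE: "s i \<otimes> E = E \<otimes> s i"
    unfolding E_def using i by (intro commute_D closed s_commute) auto
  have tau_Suc: "\<tau> (Suc i) = shift E (s (Suc i) \<otimes> s (Suc i))"
    unfolding E_def using i by (intro tau_eq_shift) auto
  define q where "q = conj_by G (s i \<otimes> s i) (inv (s (Suc i)))"
  have [simp]: "q \<in> carrier G" by (simp add: q_def)
  have tau: "\<tau> i = shift E q"
    using i tau_eq_shift[of i] D_step[of "Suc i"]
    by (simp add: q_def E_def[symmetric] shift_shift shift_eq_conj_by[symmetric])
  note braid = braid_conj[OF _ _ s_braid[OF i], simplified, folded q_def]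
  show "conj_by G (\<tau> i) (s i) = conj_by G (\<tau> (Suc i)) (inv (\<tau> i))"
    unfolding tau tau_Suc by (simp add: conj_by_shift sE braid shift_conj_by shift_inv)
  show "conj_by G (\<tau> (Suc i)) (s i) = \<tau> i"
    unfolding tau tau_Suc by (simp add: conj_by_shift sE braid)
  show "conj_by G (\<tau> l) (s i) = \<tau> l" if l: "1 \<le> l" "l \<le> n" "l \<noteq> i" "l \<noteq> Suc i" for l
  proof (cases "l < i")
    case True
    \<comment> \<open>On passing \<open>D (Suc l)\<close>, \<open>\<sigma>\<^sub>i\<close> becomes
      \<open>\<sigma>\<^sub>i\<^sub>+\<^sub>1\<close>, which is far enough from
      \<open>\<sigma>\<^sub>l\<close> to commute with it.\<close>
    have "s (Suc i) \<otimes> (s l \<otimes> s l) = (s l \<otimes> s l) \<otimes> s (Suc i)"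
      using True l i by (intro commute_mult closed s_commute) auto
    thus ?thesis
      using True l i s_D_shift[of "Suc l" i]
      by (simp only: tau_eq_shift) (subst conj_by_shift_transport[where y' = "s (Suc i)"],
        auto simp: D_closed closed conj_by_fixed)
  next
    case False
    have "s i \<otimes> (s l \<otimes> s l) = (s l \<otimes> s l) \<otimes> s i"
      using False l i by (intro commute_mult closed s_commute) auto
    moreover have "s i \<otimes> D (Suc l) = D (Suc l) \<otimes> s i"
      using False l i by (intro commute_D closed s_commute) auto
    ultimately show ?thesis
      using l by (simp only: tau_eq_shift) (simp add: conj_by_shift D_closed closed conj_by_fixed)
  qed
  show "conj_by G (w r) (s i) = w r" if r: "1 \<le> r" "r \<le> g" for r
    unfolding w_eq_shift using r i s_D_shift[of 1 i] a_s_commute[of r "Suc i"]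
    by (subst conj_by_shift_transport[where y' = "s (Suc i)"]) (auto simp: D_closed closed conj_by_fixed)
  show "conj_by G (\<xi> j) (s i) = \<xi> j" if j: "1 \<le> j" "j \<le> p - 1" for j
    unfolding xi_eq_shift using j i s_D_shift[of 1 i] z_s_commute[of j "Suc i"]
    by (subst conj_by_shift_transport[where y' = "s (Suc i)"]) (auto simp: D_closed closed conj_by_fixed)
qed

text \<open>Since \<open>a\<^sub>r\<close> commutes with \<open>D 2\<close>, this conjugator is
  stripped from all basis elements, and the identities for \<open>\<sigma>\<^sub>1\<close> and its
  square apply.\<close>

lemma a_conj:
  assumes r: "1 \<le> r" "r \<le> g"
  defines "c \<equiv> w r \<otimes> \<tau> 1 \<otimes> inv (w r) \<otimes> \<tau> 1"
  shows "conj_by G (\<tau> 1) (a r) = conj_by G (inv (\<tau> 1)) (inv (w r) \<otimes> \<tau> 1)"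
    and "\<And>i. 2 \<le> i \<Longrightarrow> i \<le> n \<Longrightarrow> conj_by G (\<tau> i) (a r) = \<tau> i"
    and "\<And>t. 1 \<le> t \<Longrightarrow> t < r \<Longrightarrow> conj_by G (w t) (a r) = conj_by G (w t) c"
    and "conj_by G (w r) (a r) = inv (\<tau> 1) \<otimes> w r"
    and "\<And>t. r < t \<Longrightarrow> t \<le> g \<Longrightarrow> conj_by G (w t) (a r) = w t"
    and "\<And>j. 1 \<le> j \<Longrightarrow> j \<le> p - 1 \<Longrightarrow> conj_by G (\<xi> j) (a r) = conj_by G (\<xi> j) c"
proof -
  note One_nat_def [simp del]
  define E where "E = D 2"
  define v where "v x = conj_by G x (inv (s 1))" for x
  define T where "T = s 1 \<otimes> s 1"
  have E [simp]: "E \<in> carrier G" and s1 [simp]: "s 1 \<in> carrier G" and ar [simp]: "a r \<in> carrier G"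
    using r n_gt_1 by (simp_all add: E_def D_closed closed)
  have [simp]: "T \<in> carrier G" and v [simp]: "\<And>x. x \<in> carrier G \<Longrightarrow> v x \<in> carrier G"
    by (simp_all add: T_def v_def)
  have aE: "a r \<otimes> E = E \<otimes> a r"
    unfolding E_def using r n_gt_1 by (intro commute_D closed a_s_commute) auto
  have tau: "\<tau> 1 = shift E T" by (simp only: tau_1 E_def T_def)
  have w: "w t = shift E (v (a t))" if "1 \<le> t" "t \<le> g" for t
    using that by (simp only: w_eq_shift shift_D_1 a_closed E_def v_def)
  have xi: "\<xi> j = shift E (v (z j))" if "1 \<le> j" "j \<le> p - 1" for j
    using that by (simp only: xi_eq_shift shift_D_1 z_closed E_def v_def)
  note crosscap = crosscap_conj[OF s1 ar a_a[OF r], folded T_def v_def]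
  show "conj_by G (\<tau> 1) (a r) = conj_by G (inv (\<tau> 1)) (inv (w r) \<otimes> \<tau> 1)"
    unfolding tau w[OF r] by (simp add: conj_by_shift aE crosscap shift_conj_by shift_inv shift_mult)
  show "conj_by G (w r) (a r) = inv (\<tau> 1) \<otimes> w r"
    unfolding tau w[OF r] by (simp add: conj_by_shift aE crosscap shift_inv shift_mult)
  show "conj_by G (\<tau> i) (a r) = \<tau> i" if i: "2 \<le> i" "i \<le> n" for i
  proof -
    have "a r \<otimes> (s i \<otimes> s i) = (s i \<otimes> s i) \<otimes> a r"
      using i r by (intro commute_mult closed a_s_commute) auto
    moreover have "a r \<otimes> D (Suc i) = D (Suc i) \<otimes> a r"
      using i r by (intro commute_D closed a_s_commute) auto
    ultimately show ?thesis
      using i by (simp only: tau_eq_shift) (simp add: tau_eq_shift conj_by_shift D_closed closed conj_by_fixed)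
  qed
  \<comment> \<open>The exponent supplied by \<open>conj_by_commute_shift\<close> is
    \<open>T\<close> times the inverse of \<open>T^(a r)\<close>; the shift by \<open>E\<close>
    turns it into \<open>c\<close>.\<close>
  have "T \<otimes> inv (conj_by G (inv T) (inv (v (a r)) \<otimes> T)) = v (a r) \<otimes> T \<otimes> inv (v (a r)) \<otimes> T"
    by (simp add: conj_by_def m_assoc inv_mult_group)
  hence twist: "shift E (conj_by G (v x) (a r)) = conj_by G (shift E (v x)) c"
    if "x \<in> carrier G" "inv (s 1) \<otimes> x \<otimes> s 1 \<otimes> a r = a r \<otimes> (inv (s 1) \<otimes> x \<otimes> s 1)" for x
    using that conj_by_commute_shift[OF s1 that(1) ar that(2), folded T_def v_def]
    unfolding c_def tau w[OF r]
    by (simp add: crosscap shift_conj_by shift_inv shift_mult)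
  show "conj_by G (w t) (a r) = conj_by G (w t) c" if "1 \<le> t" "t < r" for t
    using twist[OF a_closed a_a_commute[of t r]] that r by (simp only: w) (simp add: conj_by_shift aE closed)
  show "conj_by G (\<xi> j) (a r) = conj_by G (\<xi> j) c" if "1 \<le> j" "j \<le> p - 1" for j
    using twist[OF z_closed z_a_commute[of j r]] that r by (simp only: xi) (simp add: conj_by_shift aE closed)
  \<comment> \<open>Now \<open>r\<close> is the smaller index, so the relation makes
    \<open>a t\<close> commute with the conjugate of \<open>a r\<close> by
    \<open>\<sigma>\<^sub>1\<close>.\<close>
  show "conj_by G (w t) (a r) = w t" if "r < t" "t \<le> g" for t
    using commute_shift[OF s1 _ ar a_a_commute[of r t], folded v_def] that r
    by (simp only: w) (simp add: conj_by_shift aE closed)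
qed

text \<open>The pattern of \<open>a_conj\<close>, with \<open>boundary_conj\<close> in place of
  \<open>crosscap_conj\<close>; the exponent is now a commutator.\<close>

lemma z_conj:
  assumes j: "1 \<le> j" "j \<le> p - 1"
  shows "conj_by G (\<tau> 1) (z j) = commutator G (\<tau> 1) (inv (\<xi> j)) \<otimes> \<tau> 1"
    and "\<And>i. 2 \<le> i \<Longrightarrow> i \<le> n \<Longrightarrow> conj_by G (\<tau> i) (z j) = \<tau> i"
    and "\<And>r. 1 \<le> r \<Longrightarrow> r \<le> g \<Longrightarrow> conj_by G (w r) (z j) = w r"
    and "\<And>l. 1 \<le> l \<Longrightarrow> l < j \<Longrightarrow> conj_by G (\<xi> l) (z j) = conj_by G (\<xi> l) (commutator G (inv (\<xi> j)) (\<tau> 1))"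
    and "conj_by G (\<xi> j) (z j) = conj_by G (\<xi> j) (\<tau> 1)"
    and "\<And>l. j < l \<Longrightarrow> l \<le> p - 1 \<Longrightarrow> conj_by G (\<xi> l) (z j) = \<xi> l"
proof -
  note One_nat_def [simp del]
  define E where "E = D 2"
  define v where "v x = conj_by G x (inv (s 1))" for x
  define T where "T = s 1 \<otimes> s 1"
  have E [simp]: "E \<in> carrier G" and s1 [simp]: "s 1 \<in> carrier G" and zj [simp]: "z j \<in> carrier G"
    using j n_gt_1 by (simp_all add: E_def D_closed closed)
  have [simp]: "T \<in> carrier G" and v [simp]: "\<And>x. x \<in> carrier G \<Longrightarrow> v x \<in> carrier G"
    by (simp_all add: T_def v_def)
  have zE: "z j \<otimes> E = E \<otimes> z j"
    unfolding E_def using j n_gt_1 by (intro commute_D closed z_s_commute) auto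
  have tau: "\<tau> 1 = shift E T" by (simp only: tau_1 E_def T_def)
  have w: "w t = shift E (v (a t))" if "1 \<le> t" "t \<le> g" for t
    using that by (simp only: w_eq_shift shift_D_1 a_closed E_def v_def)
  have xi: "\<xi> l = shift E (v (z l))" if "1 \<le> l" "l \<le> p - 1" for l
    using that by (simp only: xi_eq_shift shift_D_1 z_closed E_def v_def)
  have comm_closed [simp]: "commutator G x y \<in> carrier G" if "x \<in> carrier G" "y \<in> carrier G" for x y
    using that by (simp add: commutator_def)
  note boundary = boundary_conj[OF s1 zj z_z[OF j], folded T_def v_def]
  show "conj_by G (\<tau> 1) (z j) = commutator G (\<tau> 1) (inv (\<xi> j)) \<otimes> \<tau> 1"
    unfolding tau xi[OF j]
    by (simp add: conj_by_shift zE boundary shift_inv shift_mult shift_commutator)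
  show "conj_by G (\<xi> j) (z j) = conj_by G (\<xi> j) (\<tau> 1)"
    unfolding tau xi[OF j] by (simp add: conj_by_shift zE boundary shift_conj_by)
  show "conj_by G (\<tau> i) (z j) = \<tau> i" if i: "2 \<le> i" "i \<le> n" for i
  proof -
    have "z j \<otimes> (s i \<otimes> s i) = (s i \<otimes> s i) \<otimes> z j"
      using i j by (intro commute_mult closed z_s_commute) auto
    moreover have "z j \<otimes> D (Suc i) = D (Suc i) \<otimes> z j"
      using i j by (intro commute_D closed z_s_commute) auto
    ultimately show ?thesis
      using i by (simp only: tau_eq_shift) (simp add: tau_eq_shift conj_by_shift D_closed closed conj_by_fixed)
  qed
  have "T \<otimes> inv (commutator G T (inv (v (z j))) \<otimes> T) = commutator G (inv (v (z j))) T"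
    by (simp add: commutator_def m_assoc inv_mult_group)
  hence twist: "shift E (conj_by G (v x) (z j)) = conj_by G (shift E (v x)) (commutator G (inv (\<xi> j)) (\<tau> 1))"
    if "x \<in> carrier G" "inv (s 1) \<otimes> x \<otimes> s 1 \<otimes> z j = z j \<otimes> (inv (s 1) \<otimes> x \<otimes> s 1)" for x
    using that conj_by_commute_shift[OF s1 that(1) zj that(2), folded T_def v_def]
    unfolding tau xi[OF j]
    by (simp add: boundary shift_conj_by shift_inv shift_commutator)
  show "conj_by G (\<xi> l) (z j) = conj_by G (\<xi> l) (commutator G (inv (\<xi> j)) (\<tau> 1))" if "1 \<le> l" "l < j" for l
    using twist[OF z_closed z_z_commute[of l j]] that j
    by (simp only: xi) (simp add: xi conj_by_shift zE closed)
  show "conj_by G (w r) (z j) = w r" if "1 \<le> r" "r \<le> g" for r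
    using commute_shift[OF s1 _ zj z_a_commute[of j r], folded v_def] that j
    by (simp only: w) (simp add: conj_by_shift zE closed)
  show "conj_by G (\<xi> l) (z j) = \<xi> l" if "j < l" "l \<le> p - 1" for l
    using commute_shift[OF s1 _ zj z_z_commute[of j l], folded v_def] that j
    by (simp only: xi) (simp add: conj_by_shift zE closed)
qed

end

section \<open>The action on W\<close>

lemma (in group) conj_by_image_subgroup:
  assumes "subgroup K G" "b \<in> carrier G"
  shows "subgroup ((\<lambda>u. conj_by G u b) ` K) G"
proof
  note K = subgroup.mem_carrier[OF assms(1)]
  show "(\<lambda>u. conj_by G u b) ` K \<subseteq> carrier G"
    using K assms by auto
  show "x \<otimes> y \<in> (\<lambda>u. conj_by G u b) ` K"
    if xy: "x \<in> (\<lambda>u. conj_by G u b) ` K" "y \<in> (\<lambda>u. conj_by G u b) ` K" for x y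
  proof -
    from xy obtain u v where "u \<in> K" "v \<in> K" "x = conj_by G u b" "y = conj_by G v b" by auto
    thus ?thesis
      using K assms by (intro image_eqI[of _ _ "u \<otimes> v"]) (auto simp: conj_by_mult subgroup.m_closed)
  qed
  show "\<one> \<in> (\<lambda>u. conj_by G u b) ` K"
    using assms by (intro image_eqI[of _ _ \<one>]) (auto simp: subgroup.one_closed)
  show "inv x \<in> (\<lambda>u. conj_by G u b) ` K" if x: "x \<in> (\<lambda>u. conj_by G u b) ` K" for x
  proof -
    from x obtain u where "u \<in> K" "x = conj_by G u b" by auto
    thus ?thesis
      using K assms by (intro image_eqI[of _ _ "inv u"]) (auto simp: conj_by_inv subgroup.m_inv_closed)
  qed
qed

text \<open>The second condition says that the conjugates of the generators still generate them.\<close>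

lemma (in group) conj_by_image_generate:
  assumes H: "H \<subseteq> carrier G" and b: "b \<in> carrier G"
    and into: "\<And>h. h \<in> H \<Longrightarrow> conj_by G h b \<in> generate G H"
    and onto: "\<And>M h. subgroup M G \<Longrightarrow> (\<And>h. h \<in> H \<Longrightarrow> conj_by G h b \<in> M) \<Longrightarrow> h \<in> H \<Longrightarrow> h \<in> M"
  shows "(\<lambda>u. conj_by G u b) ` generate G H = generate G H"
proof
  note K = generate_is_subgroup[OF H]
  show "(\<lambda>u. conj_by G u b) ` generate G H \<subseteq> generate G H"
  proof clarify
    fix u assume "u \<in> generate G H"
    thus "conj_by G u b \<in> generate G H"
    proof induction
      case (inv h)
      thus ?case using H b into[of h] by (auto simp: conj_by_inv subgroup.m_inv_closed[OF K])
    next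
      case (eng h k)
      thus ?case using generate_in_carrier[OF H] b by (simp add: conj_by_mult generate.eng)
    qed (use b into in \<open>auto intro: generate.one\<close>)
  qed
  show "generate G H \<subseteq> (\<lambda>u. conj_by G u b) ` generate G H"
  proof (rule generate_subgroup_incl)
    show M: "subgroup ((\<lambda>u. conj_by G u b) ` generate G H) G"
      by (rule conj_by_image_subgroup[OF K b])
    show "H \<subseteq> (\<lambda>u. conj_by G u b) ` generate G H"
      \<comment> \<open>The image is itself a subgroup that contains all conjugates of the
        generators, so it can serve as \<open>M\<close>.\<close>
      using onto[OF M] by (auto intro: generate.incl)
  qed
qed

section \<open>Solving equations inside a subgroup\<close>

lemma (in group) subgroup_conj_by_closed:
  "subgroup M G \<Longrightarrow> x \<in> M \<Longrightarrow> y \<in> M \<Longrightarrow> conj_by G x y \<in> M"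
  by (simp add: conj_by_def subgroup.m_closed subgroup.m_inv_closed)

lemma (in group) subgroup_conj_by_cancel:
  assumes "subgroup M G" "conj_by G x y \<in> M" "y \<in> M" "x \<in> carrier G"
  shows "x \<in> M"
proof -
  have "y \<in> carrier G" using assms by (auto intro: subgroup.mem_carrier)
  hence "x = conj_by G (conj_by G x y) (inv y)"
    using assms by (simp add: conj_by_conj_by)
  thus ?thesis
    using assms by (metis subgroup_conj_by_closed subgroup.m_inv_closed)
qed

lemma (in group) subgroup_inv_cancel:
  "subgroup M G \<Longrightarrow> inv x \<in> M \<Longrightarrow> x \<in> carrier G \<Longrightarrow> x \<in> M"
  using subgroup.m_inv_closed[of M G "inv x"] by simp

lemma (in group) subgroup_mult_left_cancel:
  assumes "subgroup M G" "x \<otimes> y \<in> M" "x \<in> M" "y \<in> carrier G"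
  shows "y \<in> M"
proof -
  have "x \<in> carrier G" using assms by (auto intro: subgroup.mem_carrier)
  hence "y = inv x \<otimes> (x \<otimes> y)" using assms by simp
  thus ?thesis using assms by (metis subgroup.m_closed subgroup.m_inv_closed)
qed

context surface_braid
begin

lemma W_elem_closed: "W_elem G f n ` W_gens n g p \<subseteq> carrier G"
  unfolding W_gens_def by (auto simp del: W_elem.simps intro: tau_closed w_closed xi_closed)

lemma W_subgroup: "subgroup W G"
  by (rule generate_is_subgroup[OF W_elem_closed])

lemma W_image_cases:
  assumes "h \<in> W_elem G f n ` W_gens n g p"
  obtains (tau) k where "1 \<le> k" "k \<le> n" "h = \<tau> k"
  | (w) r where "1 \<le> r" "r \<le> g" "h = w r"
  | (xi) j where "1 \<le> j" "j \<le> p - 1" "h = \<xi> j"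
  using assms unfolding W_gens_def by (auto simp del: W_elem.simps)

lemma tau_in_image: "1 \<le> k \<Longrightarrow> k \<le> n \<Longrightarrow> \<tau> k \<in> W_elem G f n ` W_gens n g p"
  and w_in_image: "1 \<le> r \<Longrightarrow> r \<le> g \<Longrightarrow> w r \<in> W_elem G f n ` W_gens n g p"
  and xi_in_image: "1 \<le> j \<Longrightarrow> j \<le> p - 1 \<Longrightarrow> \<xi> j \<in> W_elem G f n ` W_gens n g p"
  unfolding W_gens_def by (auto simp del: W_elem.simps)

lemmas in_image = tau_in_image w_in_image xi_in_image
lemmas in_W = in_image[THEN generate.incl]
lemmas basis_closed = tau_closed w_closed xi_closed
lemmas W_intros = in_W subgroup.m_closed[OF W_subgroup] subgroup.m_inv_closed[OF W_subgroup]
  subgroup_conj_by_closed[OF W_subgroup]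

lemma sigma_conj_W:
  assumes i: "1 \<le> i" "i < n"
  shows "(\<lambda>u. conj_by G u (s i)) ` W = W"
proof (rule conj_by_image_generate[OF W_elem_closed])
  show "s i \<in> carrier G" using i by (intro closed) auto
next
  fix h assume "h \<in> W_elem G f n ` W_gens n g p"
  thus "conj_by G h (s i) \<in> W"
  proof (cases rule: W_image_cases)
    case (tau k)
    consider "k = i" | "k = Suc i" | "k \<noteq> i" "k \<noteq> Suc i" by blast
    thus ?thesis
    proof cases
      case 1
      show ?thesis unfolding tau 1 sigma_conj(1)[OF i] using i by (intro W_intros) auto
    next
      case 2
      show ?thesis unfolding tau 2 sigma_conj(2)[OF i] using i by (intro W_intros) auto
    next
      case 3
      show ?thesis
        by (simp only: tau(3) sigma_conj(3)[OF i tau(1,2) 3] in_W(1)[OF tau(1,2)])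
    qed
  next
    case (w r)
    with i show ?thesis by (simp only: sigma_conj in_W)
  next
    case (xi j)
    with i show ?thesis by (simp only: sigma_conj in_W)
  qed
next
  fix M h
  assume M: "subgroup M G" and conj: "\<And>h. h \<in> W_elem G f n ` W_gens n g p \<Longrightarrow> conj_by G h (s i) \<in> M"
    and h: "h \<in> W_elem G f n ` W_gens n g p"
  \<comment> \<open>The element \<open>\<tau>\<^sub>i\<close> is the conjugate of
    \<open>\<tau>\<^sub>i\<^sub>+\<^sub>1\<close>. Once it lies in \<open>M\<close>, the conjugate
    of \<open>\<tau>\<^sub>i\<close> can be solved for
    \<open>\<tau>\<^sub>i\<^sub>+\<^sub>1\<close>.\<close>
  have tau_i: "\<tau> i \<in> M"
    using conj[OF tau_in_image[of "Suc i"]] i by (simp add: sigma_conj(2) del: W_elem.simps)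
  have tau_Suc: "\<tau> (Suc i) \<in> M"
  proof (rule subgroup_conj_by_cancel[OF M])
    show "conj_by G (\<tau> (Suc i)) (inv (\<tau> i)) \<in> M"
      using conj[OF tau_in_image[of i]] i by (simp add: sigma_conj(1) del: W_elem.simps)
  qed (use M tau_i i in \<open>auto simp del: W_elem.simps intro: subgroup.m_inv_closed tau_closed\<close>)
  from h show "h \<in> M"
  proof (cases rule: W_image_cases)
    case (tau k)
    consider "k = i" | "k = Suc i" | "k \<noteq> i" "k \<noteq> Suc i" by blast
    thus ?thesis
    proof cases
      case 3
      show ?thesis
        using conj[OF h] by (simp only: tau(3) sigma_conj(3)[OF i tau(1,2) 3])
    qed (use tau tau_i tau_Suc in simp_all)
  next
    case (w r)
    with i conj[OF h] show ?thesis by (simp only: sigma_conj)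
  next
    case (xi j)
    with i conj[OF h] show ?thesis by (simp only: sigma_conj)
  qed
qed

lemma a_conj_W:
  assumes r: "1 \<le> r" "r \<le> g"
  shows "(\<lambda>u. conj_by G u (a r)) ` W = W"
proof (rule conj_by_image_generate[OF W_elem_closed])
  show "a r \<in> carrier G" using r by (rule closed)
next
  define c where "c = w r \<otimes> \<tau> 1 \<otimes> inv (w r) \<otimes> \<tau> 1"
  note conj_a = a_conj[OF r, folded c_def]
  have n1: "1 \<le> n" using n_gt_1 by simp
  fix h assume "h \<in> W_elem G f n ` W_gens n g p"
  have c: "c \<in> W"
    unfolding c_def using r n1 by (intro W_intros) auto
  from \<open>h \<in> _\<close> show "conj_by G h (a r) \<in> W"
  proof (cases rule: W_image_cases)
    case (tau k)
    show ?thesis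
    proof (cases "k = 1")
      case True
      show ?thesis unfolding tau True conj_a(1) using r n1 by (intro W_intros) auto
    next
      case False
      with tau show ?thesis by (simp only: conj_a in_W)
    qed
  next
    case (w t)
    consider "t < r" | "t = r" | "r < t" by linarith
    thus ?thesis
    proof cases
      case 1
      with w conj_a(3)[of t] c show ?thesis by (simp only: subgroup_conj_by_closed[OF W_subgroup] in_W)
    next
      case 2
      show ?thesis unfolding w 2 conj_a(4) using r n1 by (intro W_intros) auto
    next
      case 3
      with w show ?thesis by (simp only: conj_a in_W)
    qed
  next
    case (xi j)
    with conj_a(6)[of j] c show ?thesis by (simp only: subgroup_conj_by_closed[OF W_subgroup] in_W)
  qed
next
  define c where "c = w r \<otimes> \<tau> 1 \<otimes> inv (w r) \<otimes> \<tau> 1"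
  note conj_a = a_conj[OF r, folded c_def]
  have n1: "1 \<le> n" using n_gt_1 by simp
  fix M h
  assume M: "subgroup M G" and conj: "\<And>h. h \<in> W_elem G f n ` W_gens n g p \<Longrightarrow> conj_by G h (a r) \<in> M"
    and h: "h \<in> W_elem G f n ` W_gens n g p"
  note M_intros = subgroup.m_closed[OF M] subgroup.m_inv_closed[OF M]
  have tau1_closed: "\<tau> 1 \<in> carrier G" and wr_closed: "w r \<in> carrier G"
    using r n1 by (intro basis_closed; simp)+
  \<comment> \<open>The conjugate of \<open>w r\<close> is the inverse of the exponent in the
    conjugate of \<open>\<tau> 1\<close>. So that exponent lies in \<open>M\<close>, and
    \<open>\<tau> 1\<close>, \<open>w r\<close> and \<open>c\<close> follow in turn.\<close>
  have y: "inv (\<tau> 1) \<otimes> w r \<in> M"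
    using conj[OF w_in_image[OF r]] by (simp only: conj_a)
  have "inv (inv (\<tau> 1) \<otimes> w r) \<in> M"
    by (intro M_intros y)
  hence "inv (w r) \<otimes> \<tau> 1 \<in> M"
    using tau1_closed wr_closed by (simp only: inv_mult_group inv_closed inv_inv)
  moreover have "conj_by G (inv (\<tau> 1)) (inv (w r) \<otimes> \<tau> 1) \<in> M"
    using conj[OF tau_in_image[OF le_refl n1]] by (simp only: conj_a)
  ultimately have inv_tau1: "inv (\<tau> 1) \<in> M"
    using tau1_closed by (blast intro: subgroup_conj_by_cancel[OF M])
  hence tau1: "\<tau> 1 \<in> M"
    using tau1_closed by (rule subgroup_inv_cancel[OF M])
  have wr: "w r \<in> M"
    by (rule subgroup_mult_left_cancel[OF M y inv_tau1 wr_closed])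
  have c: "c \<in> M" unfolding c_def by (intro M_intros tau1 wr)
  from h show "h \<in> M"
  proof (cases rule: W_image_cases)
    case (tau k)
    show ?thesis
    proof (cases "k = 1")
      case True
      with tau tau1 show ?thesis by simp
    next
      case False
      with tau conj[OF h] show ?thesis by (simp only: conj_a)
    qed
  next
    case (w t)
    consider "t < r" | "t = r" | "r < t" by linarith
    thus ?thesis
    proof cases
      case 1
      with w conj[OF h] conj_a(3)[of t] c show ?thesis
        by (metis subgroup_conj_by_cancel[OF M] w_closed)
    next
      case 2
      with w wr show ?thesis by simp
    next
      case 3
      with w conj[OF h] show ?thesis by (simp only: conj_a)
    qed
  next
    case (xi j)
    with conj[OF h] conj_a(6)[of j] c show ?thesis
      by (metis subgroup_conj_by_cancel[OF M] xi_closed)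
  qed
qed

lemma z_conj_W:
  assumes j: "1 \<le> j" "j \<le> p - 1"
  shows "(\<lambda>u. conj_by G u (z j)) ` W = W"
proof (rule conj_by_image_generate[OF W_elem_closed])
  show "z j \<in> carrier G" using j by (rule closed)
next
  define c where "c = commutator G (inv (\<xi> j)) (\<tau> 1)"
  note conj_z = z_conj[OF j, folded c_def]
  have n1: "1 \<le> n" using n_gt_1 by simp
  fix h assume "h \<in> W_elem G f n ` W_gens n g p"
  have c: "c \<in> W"
    unfolding c_def commutator_def using j n1 by (intro W_intros) auto
  from \<open>h \<in> _\<close> show "conj_by G h (z j) \<in> W"
  proof (cases rule: W_image_cases)
    case (tau k)
    show ?thesis
    proof (cases "k = 1")
      case True
      show ?thesis unfolding tau True conj_z(1) commutator_def using j n1 by (intro W_intros) auto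
    next
      case False
      with tau show ?thesis by (simp only: conj_z in_W)
    qed
  next
    case (xi t)
    consider "t < j" | "t = j" | "j < t" by linarith
    thus ?thesis
    proof cases
      case 1
      with xi conj_z(4)[of t] c show ?thesis by (simp only: subgroup_conj_by_closed[OF W_subgroup] in_W)
    next
      case 2
      show ?thesis unfolding xi 2 conj_z(5) using j n1 by (intro W_intros) auto
    next
      case 3
      with xi show ?thesis by (simp only: conj_z in_W)
    qed
  next
    case (w r)
    thus ?thesis by (simp only: conj_z in_W)
  qed
next
  define c where "c = commutator G (inv (\<xi> j)) (\<tau> 1)"
  note conj_z = z_conj[OF j, folded c_def]
  have n1: "1 \<le> n" using n_gt_1 by simp
  fix M h
  assume M: "subgroup M G" and conj: "\<And>h. h \<in> W_elem G f n ` W_gens n g p \<Longrightarrow> conj_by G h (z j) \<in> M"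
    and h: "h \<in> W_elem G f n ` W_gens n g p"
  note M_intros = subgroup.m_closed[OF M] subgroup.m_inv_closed[OF M]
  have tau1_closed [simp]: "\<tau> 1 \<in> carrier G" and xi_j_closed [simp]: "\<xi> j \<in> carrier G"
    using j n1 by (intro basis_closed; simp)+
  \<comment> \<open>Conjugation by \<open>z\<^sub>j\<close> acts on \<open>\<tau>\<^sub>1\<close> and \<open>\<xi>\<^sub>j\<close> as conjugation by \<open>k\<close>, and hence fixes \<open>k\<close>.\<close>
  define k where "k = inv (\<xi> j) \<otimes> \<tau> 1"
  have k_closed: "k \<in> carrier G" by (simp add: k_def del: W_elem.simps One_nat_def)
  have tau1_k: "conj_by G (\<tau> 1) k \<in> M" and xi_k: "conj_by G (\<xi> j) k \<in> M"
  proof -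
    have "conj_by G (\<tau> 1) k = commutator G (\<tau> 1) (inv (\<xi> j)) \<otimes> \<tau> 1"
      by (simp add: k_def conj_by_def commutator_def inv_mult_group m_assoc del: W_elem.simps One_nat_def)
    thus "conj_by G (\<tau> 1) k \<in> M"
      using conj[OF tau_in_image[OF le_refl n1]] by (simp only: conj_z)
    have "conj_by G (\<xi> j) k = conj_by G (\<xi> j) (\<tau> 1)"
      by (simp add: k_def conj_by_def inv_mult_group m_assoc del: W_elem.simps One_nat_def)
    thus "conj_by G (\<xi> j) k \<in> M"
      using conj[OF xi_in_image[OF j]] by (simp only: conj_z)
  qed
  have "inv (conj_by G (\<xi> j) k) \<otimes> conj_by G (\<tau> 1) k \<in> M"
    by (intro M_intros tau1_k xi_k)
  also have "inv (conj_by G (\<xi> j) k) \<otimes> conj_by G (\<tau> 1) k = conj_by G k k"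
    using k_closed by (subst (3) k_def) (simp add: conj_by_mult conj_by_inv del: W_elem.simps One_nat_def)
  also have "\<dots> = k"
    using k_closed by (simp add: conj_by_fixed)
  finally have k: "k \<in> M" .
  have tau1: "\<tau> 1 \<in> M" and xi_j: "\<xi> j \<in> M"
    using subgroup_conj_by_cancel[OF M _ k] tau1_k xi_k tau1_closed xi_j_closed by blast+
  have c: "c \<in> M" unfolding c_def commutator_def by (intro M_intros tau1 xi_j)
  from h show "h \<in> M"
  proof (cases rule: W_image_cases)
    case (tau k)
    show ?thesis
    proof (cases "k = 1")
      case True
      with tau tau1 show ?thesis by simp
    next
      case False
      with tau conj[OF h] show ?thesis by (simp only: conj_z)
    qed
  next
    case (xi t)
    consider "t < j" | "t = j" | "j < t" by linarith
    thus ?thesis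
    proof cases
      case 1
      with xi conj[OF h] conj_z(4)[of t] c show ?thesis
        by (metis subgroup_conj_by_cancel[OF M] xi_closed)
    next
      case 2
      with xi xi_j show ?thesis by simp
    next
      case 3
      with xi conj[OF h] show ?thesis by (simp only: conj_z)
    qed
  next
    case (w r)
    with conj[OF h] show ?thesis by (simp only: conj_z)
  qed
qed

section \<open>Conjugation by the braid group as automorphisms of W\<close>

lemma generate_closed: "b \<in> generate G (f ` braid_gens n g p) \<Longrightarrow> b \<in> carrier G"
proof (rule generate_in_carrier)
  show "f ` braid_gens n g p \<subseteq> carrier G"
    using gens_closed by (auto simp: braid_gens_def image_subset_iff)
qed

text \<open>Equality rather than inclusion is what passes to inverse generators, and it also yields
  surjectivity of the induced map.\<close>

lemma conj_W:
  assumes "b \<in> generate G (f ` braid_gens n g p)"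
  shows "(\<lambda>u. conj_by G u b) ` W = W"
proof -
  have W_carrier: "u \<in> carrier G" if "u \<in> W" for u
    using subgroup.mem_carrier[OF W_subgroup that] .
  have gen: "f x \<in> carrier G \<and> (\<lambda>u. conj_by G u (f x)) ` W = W" if "x \<in> braid_gens n g p" for x
  proof -
    from that consider i where "x = Sigma_gen i" "1 \<le> i" "i < n" | r where "x = A_gen r" "1 \<le> r" "r \<le> g"
      | j where "x = Z_gen j" "1 \<le> j" "j \<le> p - 1"
      using n_gt_1 by (fastforce simp: braid_gens_def)
    thus ?thesis
      by cases (simp_all only: sigma_conj_W a_conj_W z_conj_W closed less_imp_le simp_thms)
  qed
  from assms show ?thesis
  proof induction
    case one
    have "(\<lambda>u. conj_by G u \<one>) ` W = (\<lambda>u. u) ` W"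
      by (rule image_cong) (simp_all add: W_carrier)
    thus ?case by simp
  next
    case (incl b)
    thus ?case using gen by auto
  next
    case (inv b)
    hence b: "b \<in> carrier G" and im: "(\<lambda>u. conj_by G u b) ` W = W" using gen by auto
    \<comment> \<open>Writing \<open>W\<close> as its own image under \<open>b\<close> lets
      \<open>inv b\<close> cancel.\<close>
    have "(\<lambda>u. conj_by G u (inv b)) ` W = (\<lambda>u. conj_by G u (inv b)) ` (\<lambda>u. conj_by G u b) ` W"
      by (simp only: im)
    also have "\<dots> = (\<lambda>u. u) ` W"
      unfolding image_image by (rule image_cong) (simp_all add: conj_by_conj_by W_carrier b)
    finally show ?case by simp
  next
    case (eng b c)
    hence "(\<lambda>u. conj_by G u (b \<otimes> c)) ` W = (\<lambda>u. conj_by G (conj_by G u b) c) ` W"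
      by (intro image_cong) (simp_all add: conj_by_conj_by W_carrier generate_closed)
    also have "\<dots> = (\<lambda>u. conj_by G u c) ` (\<lambda>u. conj_by G u b) ` W"
      by (simp only: image_image)
    finally show ?case using eng by simp
  qed
qed

lemma conj_auto:
  assumes b: "b \<in> generate G (f ` braid_gens n g p)"
  shows "(\<lambda>u\<in>W. conj_by G u b) \<in> auto (G\<lparr>carrier := W\<rparr>)"
proof -
  have W_carrier: "u \<in> carrier G" if "u \<in> W" for u
    using subgroup.mem_carrier[OF W_subgroup that] .
  have b': "b \<in> carrier G" using b by (rule generate_closed)
  have im: "conj_by G u b \<in> W" if "u \<in> W" for u
    using conj_W[OF b] that by blast
  have "inj_on (\<lambda>u. conj_by G u b) W"
  proof (rule inj_on_inverseI)
    fix u assume "u \<in> W"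
    thus "conj_by G (conj_by G u b) (inv b) = u"
      using W_carrier b' by (simp add: conj_by_conj_by)
  qed
  hence "bij_betw (\<lambda>u. conj_by G u b) W W"
    by (simp add: bij_betw_def conj_W[OF b])
  hence "(\<lambda>u\<in>W. conj_by G u b) \<in> Bij W"
    by (simp add: Bij_def bij_betw_restrict_eq)
  moreover have "(\<lambda>u\<in>W. conj_by G u b) \<in> hom (G\<lparr>carrier := W\<rparr>) (G\<lparr>carrier := W\<rparr>)"
    using im b' W_carrier subgroup.m_closed[OF W_subgroup]
    by (intro homI) (simp_all add: conj_by_mult)
  ultimately show ?thesis by (simp add: auto_def)
qed

text \<open>From \<open>u^(b c) = (u^b)^c\<close>: the left factor acts first, which is why
  automorphisms act on the right.\<close>

lemma conj_compose:
  assumes "b \<in> generate G (f ` braid_gens n g p)" "c \<in> generate G (f ` braid_gens n g p)"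
  shows "(\<lambda>u\<in>W. conj_by G u (b \<otimes> c)) = compose W (\<lambda>u\<in>W. conj_by G u c) (\<lambda>u\<in>W. conj_by G u b)"
proof
  fix u
  have "conj_by G u b \<in> W" if "u \<in> W" using conj_W[OF assms(1)] that by blast
  thus "(\<lambda>u\<in>W. conj_by G u (b \<otimes> c)) u = compose W (\<lambda>u\<in>W. conj_by G u c) (\<lambda>u\<in>W. conj_by G u b) u"
    using assms subgroup.mem_carrier[OF W_subgroup, of u]
    by (cases "u \<in> W") (simp_all add: compose_def conj_by_conj_by generate_closed)
qed

section \<open>Freeness of W\<close>

lemma word_val_W_word:
  assumes "x \<in> W_gens n g p"
  shows "word_val G f (W_word n x) = W_elem G f n x"
proof -
  have gens: "Sigma_gen k \<in> braid_gens (n + 1) g p" if "x = Tau k" for k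
    using assms that by (auto simp: W_gens_def braid_gens_def)
  have gens': "A_gen r \<in> braid_gens (n + 1) g p" if "x = Omega r" for r
    using assms that by (auto simp: W_gens_def braid_gens_def)
  have gens'': "Z_gen j \<in> braid_gens (n + 1) g p" if "x = Xi j" for j
    using assms that by (auto simp: W_gens_def braid_gens_def)
  note append = word_val_append[OF gens_closed]
  note lists = desc_word_in_lists[simplified] inv_word_in_lists[OF desc_word_in_lists, simplified]
  have "f y \<in> carrier G" if "y \<in> braid_gens (n + 1) g p" for y
    using gens_closed that by auto
  note gens_val = this[OF gens] this[OF gens'] this[OF gens'']
  show ?thesis
  proof (cases x)
    case (Tau k)
    with gens[OF Tau] gens_val show ?thesis
      by (simp add: append lists word_val_inv_word[OF gens_closed] D_closed numeral_2_eq_2 m_assoc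
          flip: D_eq_word_val)
  next
    case (Omega r)
    with gens'[OF Omega] gens_val show ?thesis
      by (simp add: append lists word_val_inv_word[OF gens_closed] D_closed m_assoc
          flip: D_eq_word_val)
  next
    case (Xi j)
    with gens''[OF Xi] gens_val show ?thesis
      by (simp add: append lists word_val_inv_word[OF gens_closed] D_closed m_assoc
          flip: D_eq_word_val)
  qed
qed

lemma W_letter_word_in_lists:
  "u \<in> lists (W_gens n g p \<times> UNIV) \<Longrightarrow>
   concat (map (W_letter_word n) u) \<in> lists (braid_gens (n + 1) g p \<times> UNIV)"
proof (induction u)
  case (Cons l u)
  obtain x e where l: "l = (x, e)" by (cases l)
  hence "x \<in> W_gens n g p" using Cons by auto
  with Cons show ?case
    by (simp add: l W_word_in_lists[simplified] inv_word_in_lists)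
qed simp

lemma word_val_W_letter_words:
  assumes "u \<in> lists (W_gens n g p \<times> UNIV)"
  shows "word_val G f (concat (map (W_letter_word n) u)) = word_val G (W_elem G f n) u"
  using assms
proof (induction u)
  case (Cons l u)
  obtain x e where l: "l = (x, e)" by (cases l)
  hence x: "x \<in> W_gens n g p" using Cons by auto
  have "W_letter_word n (x, e) \<in> lists (braid_gens (n + 1) g p \<times> UNIV)"
    using W_word_in_lists[OF x] inv_word_in_lists[OF W_word_in_lists[OF x]] by simp
  hence "word_val G f (W_letter_word n (x, e) @ concat (map (W_letter_word n) u)) =
    word_val G f (W_letter_word n (x, e)) \<otimes> word_val G f (concat (map (W_letter_word n) u))"
    using Cons by (intro word_val_append[OF gens_closed] W_letter_word_in_lists) auto
  with Cons show ?case
    by (simp add: l word_val_W_word[OF x] word_val_inv_word[OF gens_closed W_word_in_lists[OF x]])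
qed simp

text \<open>Equal values of two words give, by completeness of the relations, a derivation between
  the corresponding words in the braid generators; the coset action turns it into free
  equality.\<close>

lemma W_free:
  assumes "has_presentation G f (braid_gens (n + 1) g p) (braid_rels (n + 1) g p)"
  shows "freely_generated (G\<lparr>carrier := W\<rparr>) (W_elem G f n) (W_gens n g p)"
  unfolding freely_generated_def has_presentation_def
proof (intro conjI ballI)
  let ?X = "W_gens n g p"
  show "group (G\<lparr>carrier := W\<rparr>)"
    by (rule subgroup_imp_group[OF W_subgroup])
  show "W_elem G f n ` ?X \<subseteq> carrier (G\<lparr>carrier := W\<rparr>)"
    by (auto intro: generate.incl)
  show "generate (G\<lparr>carrier := W\<rparr>) (W_elem G f n ` ?X) = carrier (G\<lparr>carrier := W\<rparr>)"
    using generate_consistent[OF _ W_subgroup, of "W_elem G f n ` ?X"] by (auto intro: generate.incl)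
  fix u v :: "W_gen word" assume u: "u \<in> lists (?X \<times> UNIV)" and v: "v \<in> lists (?X \<times> UNIV)"
  have val: "word_val (G\<lparr>carrier := W\<rparr>) (W_elem G f n) u = word_val G (W_elem G f n) u"
    if "u \<in> lists (?X \<times> UNIV)" for u :: "W_gen word"
    using that
  proof (induction u)
    case (Cons l u)
    obtain x e where l: "l = (x, e)" by (cases l)
    hence "W_elem G f n x \<in> W" using Cons by (auto intro: generate.incl)
    with Cons show ?case
      by (simp add: l word_val_def m_inv_consistent[OF W_subgroup] del: W_elem.simps)
  qed (simp add: word_val_def)
  show "word_val (G\<lparr>carrier := W\<rparr>) (W_elem G f n) u = word_val (G\<lparr>carrier := W\<rparr>) (W_elem G f n) v
    \<longleftrightarrow> pres_eq ?X {} u v"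
    unfolding val[OF u] val[OF v]
  proof
    assume "pres_eq ?X {} u v"
    thus "word_val G (W_elem G f n) u = word_val G (W_elem G f n) v"
      using word_val_pres_eq[OF _ W_elem_closed u v] by blast
  next
    assume "word_val G (W_elem G f n) u = word_val G (W_elem G f n) v"
    hence "pres_eq (braid_gens (n + 1) g p) (braid_rels (n + 1) g p)
        (concat (map (W_letter_word n) u)) (concat (map (W_letter_word n) v))"
      using assms W_letter_word_in_lists[OF u] W_letter_word_in_lists[OF v]
      unfolding has_presentation_def word_val_W_letter_words[OF u, symmetric]
        word_val_W_letter_words[OF v, symmetric] by blast
    thus "pres_eq ?X {} u v"
      by (rule pres_eq_W_letter_words[OF u v])
  qed
qed

end

lemma surface_braidI:
  assumes "n > 1" "has_presentation G f (braid_gens (n + 1) g p) (braid_rels (n + 1) g p)"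
  shows "surface_braid G f n g p"
proof -
  have pres: "group G" "f ` braid_gens (n + 1) g p \<subseteq> carrier G"
    using assms(2) by (auto simp: has_presentation_def)
  show ?thesis
  proof (intro surface_braid.intro surface_braid_axioms.intro pres assms(1))
    fix u v assume uv: "(u, v) \<in> braid_rels (n + 1) g p"
    \<comment> \<open>A presentation compares only words over its alphabet, so both sides of each
      relation are checked; \<open>n > 1\<close> makes \<open>\<sigma>\<^sub>1\<close> a
      generator.\<close>
    have "u \<in> lists (braid_gens (n + 1) g p \<times> UNIV) \<and> v \<in> lists (braid_gens (n + 1) g p \<times> UNIV)"
      using uv assms(1) unfolding braid_rels_def Let_def pos_def neg_def
      by (elim UnE CollectE exE conjE) (simp_all add: braid_gens_def image_iff)
    thus "word_val G f u = word_val G f v"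
      using assms(2) uv by (auto simp: has_presentation_def intro: pres_eq.rel)
  qed
qed

theorem theorem4:
  fixes \<Sigma> :: "'a topology" and P :: "nat \<Rightarrow> 'a" and n g p :: nat
    and e f :: "braid_gen \<Rightarrow> (nat \<times> real \<Rightarrow> 'a) set"
    and \<iota> :: "(nat \<times> real \<Rightarrow> 'a) set \<Rightarrow> (nat \<times> real \<Rightarrow> 'a) set"
  defines "B \<equiv> braid_group \<Sigma> P n" and "G \<equiv> braid_group \<Sigma> P (n + 1)"
  defines "W \<equiv> subgroup_on G (W_elem G f n ` W_gens n g p)"
  defines "\<tau> \<equiv> \<lambda>k. W_elem G f n (Tau k)"
    and "w \<equiv> \<lambda>r. W_elem G f n (Omega r)"
    and "\<xi> \<equiv> \<lambda>j. W_elem G f n (Xi j)"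
  defines "\<rho> \<equiv> \<lambda>\<beta>. \<lambda>u\<in>carrier W. conj_by G u (\<iota> \<beta>)"
  assumes "n > 1" and "p \<ge> 1" and "g \<ge> 1"
    and "nonorientable_surface g p \<Sigma>"
    and "inj_on P {1..n + 1}" and "P ` {1..n + 1} \<subseteq> surface_interior \<Sigma>"
    and "has_presentation B e (braid_gens n g p) (braid_rels n g p)"
    and "has_presentation G f (braid_gens (n + 1) g p) (braid_rels (n + 1) g p)"
    and "\<iota> \<in> iso B (subgroup_on G (f ` braid_gens n g p))"
    and "\<forall>x\<in>braid_gens n g p. \<iota> (e x) = f x"
  shows "freely_generated W (W_elem G f n) (W_gens n g p) \<and>
    \<rho> \<in> hom B (right_AutoGroup W) \<and>
    (\<forall>i\<in>{1..n - 1}. let \<phi> = \<rho> (e (Sigma_gen i)) in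
       \<phi> (\<tau> i) = conj_by G (\<tau> (i + 1)) (inv\<^bsub>G\<^esub> \<tau> i) \<and>
       \<phi> (\<tau> (i + 1)) = \<tau> i \<and>
       (\<forall>l\<in>{1..n}. l \<noteq> i \<and> l \<noteq> i + 1 \<longrightarrow> \<phi> (\<tau> l) = \<tau> l) \<and>
       (\<forall>r\<in>{1..g}. \<phi> (w r) = w r) \<and>
       (\<forall>j\<in>{1..p - 1}. \<phi> (\<xi> j) = \<xi> j)) \<and>
    (\<forall>r\<in>{1..g}. let \<phi> = \<rho> (e (A_gen r)); c = w r \<otimes>\<^bsub>G\<^esub> \<tau> 1 \<otimes>\<^bsub>G\<^esub> inv\<^bsub>G\<^esub> w r \<otimes>\<^bsub>G\<^esub> \<tau> 1 in
       \<phi> (\<tau> 1) = conj_by G (inv\<^bsub>G\<^esub> \<tau> 1) (inv\<^bsub>G\<^esub> w r \<otimes>\<^bsub>G\<^esub> \<tau> 1) \<and>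
       (\<forall>i\<in>{2..n}. \<phi> (\<tau> i) = \<tau> i) \<and>
       (\<forall>s\<in>{1..g}. s < r \<longrightarrow> \<phi> (w s) = conj_by G (w s) c) \<and>
       \<phi> (w r) = inv\<^bsub>G\<^esub> \<tau> 1 \<otimes>\<^bsub>G\<^esub> w r \<and>
       (\<forall>s\<in>{1..g}. r < s \<longrightarrow> \<phi> (w s) = w s) \<and>
       (\<forall>j\<in>{1..p - 1}. \<phi> (\<xi> j) = conj_by G (\<xi> j) c)) \<and>
    (\<forall>j\<in>{1..p - 1}. let \<phi> = \<rho> (e (Z_gen j)) in
       \<phi> (\<tau> 1) = commutator G (\<tau> 1) (inv\<^bsub>G\<^esub> \<xi> j) \<otimes>\<^bsub>G\<^esub> \<tau> 1 \<and>
       (\<forall>i\<in>{2..n}. \<phi> (\<tau> i) = \<tau> i) \<and>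
       (\<forall>r\<in>{1..g}. \<phi> (w r) = w r) \<and>
       (\<forall>l\<in>{1..p - 1}. l < j \<longrightarrow>
          \<phi> (\<xi> l) = conj_by G (\<xi> l) (commutator G (inv\<^bsub>G\<^esub> \<xi> j) (\<tau> 1))) \<and>
       \<phi> (\<xi> j) = conj_by G (\<xi> j) (\<tau> 1) \<and>
       (\<forall>l\<in>{1..p - 1}. j < l \<longrightarrow> \<phi> (\<xi> l) = \<xi> l))"
proof -
  interpret L: surface_braid G f n g p
    using assms by (intro surface_braidI) simp_all
  note tau_def = assms(4) and w_def = assms(5) and xi_def = assms(6)
  let ?W = "generate G (W_elem G f n ` W_gens n g p)" and ?K = "generate G (f ` braid_gens n g p)"
  have W_eq: "W = G\<lparr>carrier := ?W\<rparr>"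
    by (simp add: assms(3) subgroup_on_def)
  have iota_hom: "\<iota> \<in> hom B (subgroup_on G (f ` braid_gens n g p))"
    using assms(16) by (simp add: iso_def)
  have iota_closed: "\<iota> b \<in> ?K" if "b \<in> carrier B" for b
    using hom_in_carrier[OF iota_hom that] by (simp add: subgroup_on_def)
  have iota_mult: "\<iota> (b \<otimes>\<^bsub>B\<^esub> c) = \<iota> b \<otimes>\<^bsub>G\<^esub> \<iota> c" if "b \<in> carrier B" "c \<in> carrier B" for b c
    using hom_mult[OF iota_hom that] by (simp add: subgroup_on_def)
  have rho: "\<rho> b = (\<lambda>u\<in>?W. conj_by G u (\<iota> b))" for b
    by (simp add: assms(7) W_eq)
  have rho_gen: "\<rho> (e x) (W_elem G f n y) = conj_by G (W_elem G f n y) (f x)"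
    if "x \<in> braid_gens n g p" "y \<in> W_gens n g p" for x y
    using that assms(17) by (simp add: rho generate.incl del: W_elem.simps)
  have rho_hom: "\<rho> \<in> hom B (right_AutoGroup W)"
  proof (rule homI)
    have auto: "\<rho> b \<in> auto (G\<lparr>carrier := ?W\<rparr>)" if "b \<in> carrier B" for b
      unfolding rho by (rule L.conj_auto[OF iota_closed[OF that]])
    show "\<rho> b \<in> carrier (right_AutoGroup W)" if "b \<in> carrier B" for b
      using auto[OF that] by (simp add: right_AutoGroup_def AutoGroup_def W_eq)
    show "\<rho> (b \<otimes>\<^bsub>B\<^esub> c) = \<rho> b \<otimes>\<^bsub>right_AutoGroup W\<^esub> \<rho> c"
      if bc: "b \<in> carrier B" "c \<in> carrier B" for b c
    proof -
      \<comment> \<open>Here \<open>compose\<close> applies its second argument first, in agreement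
        with the reversed product of \<open>right_AutoGroup\<close>.\<close>
      have "\<rho> (b \<otimes>\<^bsub>B\<^esub> c) = compose ?W (\<rho> c) (\<rho> b)"
        unfolding rho iota_mult[OF bc]
        by (rule L.conj_compose[OF iota_closed[OF bc(1)] iota_closed[OF bc(2)]])
      moreover have "\<rho> b \<in> Bij ?W" "\<rho> c \<in> Bij ?W"
        using auto bc by (auto simp: auto_def)
      ultimately show ?thesis
        by (simp add: right_AutoGroup_def AutoGroup_def BijGroup_def W_eq)
    qed
  qed
  have tau_gen: "Tau k \<in> W_gens n g p" if "1 \<le> k" "k \<le> n" for k
    using that by (simp add: W_gens_def)
  have w_gen: "Omega r \<in> W_gens n g p" if "1 \<le> r" "r \<le> g" for r
    using that by (simp add: W_gens_def)
  have xi_gen: "Xi j \<in> W_gens n g p" if "1 \<le> j" "j \<le> p - 1" for j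
    using that by (simp add: W_gens_def)
  note gens = tau_gen w_gen xi_gen
  have n1: "1 \<le> n" using assms(8) by simp
  show ?thesis
  proof (intro conjI ballI)
    show "freely_generated W (W_elem G f n) (W_gens n g p)"
      unfolding W_eq by (rule L.W_free[OF assms(15)])
    show "\<rho> \<in> hom B (right_AutoGroup W)" by (rule rho_hom)
  next
    fix i assume "i \<in> {1..n - 1}"
    hence i: "1 \<le> i" "i < n" and x: "Sigma_gen i \<in> braid_gens n g p"
      using assms(8) by (auto simp: braid_gens_def)
    have "Tau i \<in> W_gens n g p" "Tau (i + 1) \<in> W_gens n g p"
      using i by (auto intro: gens)
    with L.sigma_conj[OF i] show "let \<phi> = \<rho> (e (Sigma_gen i)) in
       \<phi> (\<tau> i) = conj_by G (\<tau> (i + 1)) (inv\<^bsub>G\<^esub> \<tau> i) \<and>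
       \<phi> (\<tau> (i + 1)) = \<tau> i \<and>
       (\<forall>l\<in>{1..n}. l \<noteq> i \<and> l \<noteq> i + 1 \<longrightarrow> \<phi> (\<tau> l) = \<tau> l) \<and>
       (\<forall>r\<in>{1..g}. \<phi> (w r) = w r) \<and>
       (\<forall>j\<in>{1..p - 1}. \<phi> (\<xi> j) = \<xi> j)"
      unfolding Let_def tau_def w_def xi_def
      by (simp add: rho_gen[OF x] gens del: W_elem.simps)
  next
    fix r assume "r \<in> {1..g}"
    hence r: "1 \<le> r" "r \<le> g" and x: "A_gen r \<in> braid_gens n g p"
      by (auto simp: braid_gens_def)
    from L.a_conj[OF r] show "let \<phi> = \<rho> (e (A_gen r)); c = w r \<otimes>\<^bsub>G\<^esub> \<tau> 1 \<otimes>\<^bsub>G\<^esub> inv\<^bsub>G\<^esub> w r \<otimes>\<^bsub>G\<^esub> \<tau> 1 in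
       \<phi> (\<tau> 1) = conj_by G (inv\<^bsub>G\<^esub> \<tau> 1) (inv\<^bsub>G\<^esub> w r \<otimes>\<^bsub>G\<^esub> \<tau> 1) \<and>
       (\<forall>i\<in>{2..n}. \<phi> (\<tau> i) = \<tau> i) \<and>
       (\<forall>s\<in>{1..g}. s < r \<longrightarrow> \<phi> (w s) = conj_by G (w s) c) \<and>
       \<phi> (w r) = inv\<^bsub>G\<^esub> \<tau> 1 \<otimes>\<^bsub>G\<^esub> w r \<and>
       (\<forall>s\<in>{1..g}. r < s \<longrightarrow> \<phi> (w s) = w s) \<and>
       (\<forall>j\<in>{1..p - 1}. \<phi> (\<xi> j) = conj_by G (\<xi> j) c)"
      unfolding Let_def tau_def w_def xi_def
      by (simp add: rho_gen[OF x] gens r n1 del: W_elem.simps One_nat_def)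
  next
    fix j assume "j \<in> {1..p - 1}"
    hence j: "1 \<le> j" "j \<le> p - 1" and x: "Z_gen j \<in> braid_gens n g p"
      by (auto simp: braid_gens_def)
    from L.z_conj[OF j] show "let \<phi> = \<rho> (e (Z_gen j)) in
       \<phi> (\<tau> 1) = commutator G (\<tau> 1) (inv\<^bsub>G\<^esub> \<xi> j) \<otimes>\<^bsub>G\<^esub> \<tau> 1 \<and>
       (\<forall>i\<in>{2..n}. \<phi> (\<tau> i) = \<tau> i) \<and>
       (\<forall>r\<in>{1..g}. \<phi> (w r) = w r) \<and>
       (\<forall>l\<in>{1..p - 1}. l < j \<longrightarrow>
          \<phi> (\<xi> l) = conj_by G (\<xi> l) (commutator G (inv\<^bsub>G\<^esub> \<xi> j) (\<tau> 1))) \<and>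
       \<phi> (\<xi> j) = conj_by G (\<xi> j) (\<tau> 1) \<and>
       (\<forall>l\<in>{1..p - 1}. j < l \<longrightarrow> \<phi> (\<xi> l) = \<xi> l)"
      unfolding Let_def tau_def w_def xi_def
      by (simp add: rho_gen[OF x] gens j n1 del: W_elem.simps One_nat_def)
  qed
qed

end
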